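(* Let $\nu>0$, $\alpha\in[1,2)$, and $N_k=\lambda^k$ for some $\lambda>2^{1/(2-\alpha)}$. Then there exists $X=(X_k)_{k\ge1}$ with $X\in C([0,\infty);H^s)$ for all $s<\alpha-2$, satisfying $$X_k'=-\nu N_k^2X_k+N_k^\alpha X_{k+1}^2-N_{k-1}^\alpha X_{k-1}X_k,\qquad k=1,2,\dots,\qquad X_0=0,$$ such that $$\lim_{t\to0+}X_k(t)=0\quad\text{for } k=1,2,\dots,\qquad X\in C((0,\infty);H^s)\quad\text{for all } s\in\mathbb R,$$ and $$\limsup_{t\to0+}\,t^{\frac{r-\alpha+2}{2}}\|X(t)\|_{H^r}>0\quad\text{for all } r>\alpha-2.$$ In particular, $X$ and the zero solution are distinct solutions of this system with the same datum (zero) at $t=0$, in $C([0,\infty);H^s)$ for every $s<\alpha-2$ and in $L^\infty_tB^{\alpha-2}_{2,\infty}$.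
   Context: For a real sequence $X=(X_k)_{k\ge1}$ and $s\in\mathbb R$, $\|X\|_{H^s}^2:=\sum_{k\ge1}N_k^{2s}X_k^2$, and $H^s$ is the space of sequences with finite norm. Also $\|X\|_{B^{\alpha-2}_{2,\infty}}:=\sup_{k}N_k^{\alpha-2}|X_k|$, and $X\in L^\infty_tB^{\alpha-2}_{2,\infty}$ means that $\|X(t)\|_{B^{\alpha-2}_{2,\infty}}$ is bounded over $t\ge0$. Convention $N_0=1$ (immaterial, since $X_0=0$). Solutions are understood componentwise: each $X_k$ is a continuous function of time that satisfies the $k$-th differential equation. *)

theory Defs
  imports "HOL-Analysis.Analysis"
begin

text \<open>
  \<open>lam\<close> is the base of the frequencies \<open>N\<^sub>k = lam\<^sup>k\<close>, so \<open>N\<^sub>0 = 1\<close>.  A sequence \<open>(x\<^sub>k)\<close>, \<open>k \<ge> 1\<close>,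
  is a function \<open>nat \<Rightarrow> real\<close>; the index \<open>0\<close> carries only the boundary value \<open>X\<^sub>0 = 0\<close> and does
  not enter any norm.  A time-dependent sequence is written \<open>X t k\<close>.
\<close>

definition freq :: "real \<Rightarrow> nat \<Rightarrow> real" where
  "freq lam k = lam ^ k"

text \<open>The shift by \<open>Suc\<close> makes the sums run over \<open>k \<ge> 1\<close>.\<close>

definition H_space :: "real \<Rightarrow> real \<Rightarrow> (nat \<Rightarrow> real) set" where
  "H_space lam s = {x. summable (\<lambda>k. freq lam (Suc k) powr (2 * s) * (x (Suc k))\<^sup>2)}"

text \<open>Meaningful only on \<open>H_space lam s\<close>: the sum of a divergent series has no specified value.\<close>

definition H_norm :: "real \<Rightarrow> real \<Rightarrow> (nat \<Rightarrow> real) \<Rightarrow> real" where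
  "H_norm lam s x = sqrt (\<Sum>k. freq lam (Suc k) powr (2 * s) * (x (Suc k))\<^sup>2)"

definition continuous_in_H :: "real \<Rightarrow> real \<Rightarrow> real set \<Rightarrow> (real \<Rightarrow> nat \<Rightarrow> real) \<Rightarrow> bool" where
  "continuous_in_H lam s I X \<longleftrightarrow>
     (\<forall>t\<in>I. X t \<in> H_space lam s) \<and>
     (\<forall>t\<^sub>0\<in>I. ((\<lambda>t. H_norm lam s (\<lambda>k. X t k - X t\<^sub>0 k)) \<longlongrightarrow> 0) (at t\<^sub>0 within I))"

text \<open>The norm of \<open>B\<^bsup>\<sigma>\<^esup>\<^bsub>2,\<infinity>\<^esub>\<close>, with value \<open>\<infinity>\<close> outside the space.\<close>

definition B_norm :: "real \<Rightarrow> real \<Rightarrow> (nat \<Rightarrow> real) \<Rightarrow> ereal" where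
  "B_norm lam \<sigma> x = (SUP k\<in>{1..}. ereal (freq lam k powr \<sigma> * \<bar>x k\<bar>))"

definition bounded_in_B :: "real \<Rightarrow> real \<Rightarrow> (real \<Rightarrow> nat \<Rightarrow> real) \<Rightarrow> bool" where
  "bounded_in_B lam \<sigma> X \<longleftrightarrow> (\<exists>C::real. \<forall>t\<ge>0. B_norm lam \<sigma> (X t) \<le> ereal C)"

text \<open>
  Componentwise solutions on \<open>[0,\<infinity>)\<close>.  The derivative at \<open>t = 0\<close> is one-sided; requiring the
  equation there is no extra demand, since the components and hence the right-hand side are
  continuous on \<open>[0,\<infinity>)\<close>.
\<close>

definition dyadic_solution :: "real \<Rightarrow> real \<Rightarrow> real \<Rightarrow> (real \<Rightarrow> nat \<Rightarrow> real) \<Rightarrow> bool" where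
  "dyadic_solution \<nu> \<alpha> lam X \<longleftrightarrow>
     (\<forall>t\<ge>0. X t 0 = 0) \<and>
     (\<forall>k\<ge>1. continuous_on {0..} (\<lambda>t. X t k)) \<and>
     (\<forall>k\<ge>1. \<forall>t\<ge>0. ((\<lambda>u. X u k) has_real_derivative
        (- \<nu> * (freq lam k)\<^sup>2 * X t k
         + freq lam k powr \<alpha> * (X t (k + 1))\<^sup>2
         - freq lam (k - 1) powr \<alpha> * X t (k - 1) * X t k)) (at t within {0..}))"

end

theory Submission
  imports Defs "HOL-Complex_Analysis.Great_Picard" "HOL-Probability.Discrete_Topology"
begin

text \<open>
  Write \<open>a\<^sub>k = N\<^sub>k\<^bsup>\<alpha>-2\<^esup> X\<^sub>k\<close>, truncate the system to the modes \<open>k \<le> n\<close> and start it from the single mode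
  \<open>a\<^sub>n(0) = A\<close>, which feeds the lower modes one after the other.  A mode that reaches a large level
  \<open>M\<close> forces one of the two modes below it to reach \<open>M\<close> too, so a bound on \<open>a\<^sub>1\<close> bounds all modes;
  conversely, a mode that stays below a small threshold keeps all lower modes below it.  Tuning \<open>A\<close>
  to the largest value for which \<open>a\<^sub>1\<close> stays below a fixed level therefore yields, uniformly in \<open>n\<close>,
  \<open>threshold < sup a\<^sub>k \<le> level\<close>.  The upper bound improves itself to \<open>a\<^sub>k \<le> K exp (- \<nu> N\<^sub>k\<^sup>2 t)\<close>, hence
  each mode \<open>k < n\<close> attains the threshold at a time comparable to \<open>N\<^sub>k\<^bsup>-2\<^esup>\<close>.  All of this survives the
  limit \<open>n \<rightarrow> \<infinity>\<close>, while the initial datum escapes to infinite frequency.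
\<close>

subsection \<open>Ordinary differential equations and compactness\<close>

text \<open>The limit starts from zero, so its nontriviality has to come from bounds that are
  independent of \<open>n\<close> and hold at times that neither collapse to \<open>0\<close> nor
  escape. The energy balance cannot supply the upper bound: the quadratic terms cancel in it, but
  the tuned truncations start with energy of order \<open>N_n^(2 (2 - \<alpha>))\<close>. Hence the
  pointwise comparison arguments, which work because a mode is fed only by the next higher one,
  loses only in proportion to itself, and stays nonnegative. In the rescaled unknowns all modes obey
  the same equation up to the time scale \<open>1 / N_k^2\<close>, so constants can be uniform in
  \<open>k\<close>. The lower constant comes from \<open>\<nu> / \<mu>\<close>, where damping
  \<open>\<nu> a\<close> balances the feed \<open>\<mu> a^2\<close>. The upper one,
  \<open>10 \<nu> lam^2\<close>, makes the damping rate at most a tenth of the rate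
  \<open>M / lam^2\<close> at which a mode next to a neighbour of size \<open>M\<close> is drained.
  The blow-up rate is parabolic scaling: at a time of order \<open>N_k^(-2)\<close> the mode
  \<open>X_k\<close> has size \<open>N_k^(2 - \<alpha>)\<close>, so \<open>N_k^r X_k\<close> has
  size \<open>t^(-(r - \<alpha> + 2) / 2)\<close>.\<close>

lemma integral_exp_bound:
  fixes g :: "real \<Rightarrow> 'a::banach"
  assumes g: "continuous_on {0..t} g" "\<And>s. s \<in> {0..t} \<Longrightarrow> norm (g s) \<le> B * exp (c * s)"
    and "c > 0" "t \<ge> 0"
  shows "norm (integral {0..t} g) \<le> B / c * (exp (c * t) - 1)"
proof -
  have "((\<lambda>s. B * exp (c * s)) has_integral (B / c * exp (c * t) - B / c * exp (c * 0))) {0..t}"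
    using assms
    by (intro fundamental_theorem_of_calculus)
       (auto intro!: derivative_eq_intros simp flip: has_real_derivative_iff_has_vector_derivative)
  then have I: "integral {0..t} (\<lambda>s. B * exp (c * s)) = B / c * (exp (c * t) - 1)"
    and J: "(\<lambda>s. B * exp (c * s)) integrable_on {0..t}"
    by (auto simp: has_integral_iff algebra_simps)
  show ?thesis
    unfolding I[symmetric] using J g
    by (intro integral_norm_bound_integral integrable_continuous_real) (auto intro!: continuous_intros)
qed

text \<open>The flow is the fixed point of the Picard operator for the weight \<open>exp (- 2 L t)\<close>, which
  makes it a contraction on bounded functions on the whole half-line.\<close>

lemma lipschitz_global_flow:
  fixes F :: "'a::banach \<Rightarrow> 'a"
  assumes lip: "\<And>x y. norm (F x - F y) \<le> L * norm (x - y)" and L: "L > 0"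
  obtains \<phi> :: "real \<Rightarrow> 'a \<Rightarrow> 'a" where
    "\<And>x. \<phi> 0 x = x"
    "\<And>x t. t \<ge> 0 \<Longrightarrow> ((\<lambda>t. \<phi> t x) has_vector_derivative F (\<phi> t x)) (at t within {0..})"
    "\<And>x y t. t \<ge> 0 \<Longrightarrow> norm (\<phi> t x - \<phi> t y) \<le> 2 * exp (2 * L * t) * norm (x - y)"
proof -
  have contF: "continuous_on UNIV F"
  proof (rule lipschitz_on_continuous_on)
    show "L-lipschitz_on UNIV F" using lip L by (auto simp: lipschitz_on_def dist_norm)
  qed
  define G where "G y s = F (exp (2 * L * s) *\<^sub>R apply_bcontfun y s)" for y :: "real \<Rightarrow>\<^sub>C 'a" and s :: real
  have contG: "continuous_on S (G y)" for S y
    unfolding G_def by (intro continuous_on_compose2[OF contF] continuous_intros) auto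
  \<comment> \<open>The unknown is \<open>exp (- 2 L t)\<close> times the solution. The rate
    \<open>2 L\<close> against the Lipschitz constant \<open>L\<close> gives the contraction factor
    1/2, and from it the factor 2 in the final estimate.\<close>
  define P where "P x y t = exp (- 2 * L * t) *\<^sub>R (x + integral {0..t} (G y))" for x y t
  have contP: "continuous_on {0..} (P x y)" for x y
  proof -
    have "continuous_on {0..} (\<lambda>t. integral {0..t} (G y))"
      unfolding continuous_on_eq_continuous_within
    proof
      fix t :: real assume t: "t \<in> {0..}"
      have "continuous_on {0..t+1} (\<lambda>t. integral {0..t} (G y))"
        by (intro indefinite_integral_continuous_1 integrable_continuous_real contG)
      then have "continuous (at t within {0..t+1}) (\<lambda>t. integral {0..t} (G y))"
        using t by (auto simp: continuous_on_eq_continuous_within)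
      moreover have "at t within {0..t+1} = at t within {0..}"
        using t by (intro at_within_nhd[of _ "{..<t+1}"]) auto
      ultimately show "continuous (at t within {0..}) (\<lambda>t. integral {0..t} (G y))" by simp
    qed
    then show ?thesis unfolding P_def by (intro continuous_intros)
  qed
  have Pdiff: "norm (P x y t - P x' y' t) \<le> norm (x - x') + norm (y - y') / 2"
    if t: "t \<ge> 0" for x y x' y' t
  proof -
    have i: "G y integrable_on {0..t}" for y
      by (intro integrable_continuous_real contG)
    have b: "norm (G y s - G y' s) \<le> L * norm (y - y') * exp (2 * L * s)" for s
    proof -
      have "norm (G y s - G y' s) \<le> L * norm (exp (2 * L * s) *\<^sub>R y s - exp (2 * L * s) *\<^sub>R y' s)"
        unfolding G_def by (rule lip)
      also have "\<dots> = L * (exp (2 * L * s) * norm ((y - y') s))"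
        by (simp add: minus_bcontfun.rep_eq flip: scaleR_diff_right)
      also have "\<dots> \<le> L * (exp (2 * L * s) * norm (y - y'))"
        using L norm_bounded[of "y - y'" s] by (intro mult_left_mono) auto
      finally show ?thesis by (simp add: mult_ac)
    qed
    have "norm (integral {0..t} (\<lambda>s. G y s - G y' s)) \<le> L * norm (y - y') / (2 * L) * (exp (2 * L * t) - 1)"
      using L t b by (intro integral_exp_bound continuous_intros contG) auto
    also have "\<dots> = norm (y - y') / 2 * (exp (2 * L * t) - 1)" using L by simp
    finally have c: "norm (integral {0..t} (\<lambda>s. G y s - G y' s)) \<le> norm (y - y') / 2 * (exp (2 * L * t) - 1)" .
    have "P x y t - P x' y' t = exp (- 2 * L * t) *\<^sub>R ((x - x') + integral {0..t} (\<lambda>s. G y s - G y' s))"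
      unfolding P_def integral_diff[OF i i] by (simp add: scaleR_diff_right algebra_simps)
    then have "norm (P x y t - P x' y' t) \<le> exp (- 2 * L * t) * (norm (x - x') + norm (y - y') / 2 * (exp (2 * L * t) - 1))"
      using c norm_triangle_ineq[of "x - x'" "integral {0..t} (\<lambda>s. G y s - G y' s)"] by simp
    also have "\<dots> = exp (- 2 * L * t) * norm (x - x') + norm (y - y') / 2 * (1 - exp (- 2 * L * t))"
      by (simp add: algebra_simps exp_minus)
    also have "\<dots> \<le> 1 * norm (x - x') + norm (y - y') / 2 * 1"
      using L t by (intro add_mono mult_mono) auto
    finally show ?thesis by simp
  qed
  \<comment> \<open>\<open>F 0\<close> need not vanish; its contribution grows linearly in time and
    is absorbed by the weight.\<close>
  have P0: "norm (P 0 0 t) \<le> norm (F 0) / (2 * L)" if "t \<ge> 0" for t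
  proof -
    have "2 * L * t \<le> exp (2 * L * t)" using exp_ge_add_one_self[of "2 * L * t"] by linarith
    then have "t \<le> exp (2 * L * t) / (2 * L)" using L by (simp add: field_simps)
    then have "exp (- (2 * L * t)) * (t * norm (F 0)) \<le> exp (- (2 * L * t)) * (exp (2 * L * t) / (2 * L) * norm (F 0))"
      by (intro mult_left_mono mult_right_mono) auto
    moreover have "G 0 = (\<lambda>_. F 0)" by (simp add: G_def fun_eq_iff)
    then have "norm (P 0 0 t) = exp (- (2 * L * t)) * (t * norm (F 0))"
      using that by (simp add: P_def)
    moreover have "exp (- (2 * L * t)) * (exp (2 * L * t) / (2 * L) * norm (F 0)) = norm (F 0) / (2 * L)"
      by (simp add: exp_minus)
    ultimately show ?thesis by linarith
  qed
  \<comment> \<open>\<open>bcontfun\<close> consists of functions on the whole line, so the image is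
    frozen at its value at \<open>0\<close> for negative times.\<close>
  have Pbc: "(\<lambda>t. P x y (max 0 t)) \<in> bcontfun" for x y
  proof (rule bcontfun_normI)
    show "continuous_on UNIV (\<lambda>t. P x y (max 0 t))"
      by (intro continuous_on_compose2[OF contP] continuous_intros) auto
    show "norm (P x y (max 0 t)) \<le> norm x + norm y / 2 + norm (F 0) / (2 * L)" for t
      using Pdiff[of "max 0 t" x y 0 0] P0[of "max 0 t"]
        norm_triangle_ineq[of "P x y (max 0 t) - P 0 0 (max 0 t)" "P 0 0 (max 0 t)"] by simp
  qed
  define \<Theta> where "\<Theta> x y = Bcontfun (\<lambda>t. P x y (max 0 t))" for x y
  have \<Theta>: "apply_bcontfun (\<Theta> x y) t = P x y (max 0 t)" for x y t
    unfolding \<Theta>_def by (simp add: Bcontfun_inverse[OF Pbc])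
  have \<Theta>lip: "dist (\<Theta> x y) (\<Theta> x' y') \<le> norm (x - x') + dist y y' / 2" for x y x' y'
    by (rule dist_bound) (simp add: \<Theta> dist_norm Pdiff)
  have "\<exists>!y. \<Theta> x y = y" for x
    by (rule banach_fix_type[of "1/2"]) (use \<Theta>lip[of x _ x] in auto)
  then obtain Y where Y: "\<And>x. \<Theta> x (Y x) = Y x" by metis
  define \<phi> where "\<phi> t x = exp (2 * L * t) *\<^sub>R apply_bcontfun (Y x) t" for t x
  have \<phi>_eq: "\<phi> t x = x + integral {0..t} (\<lambda>s. F (\<phi> s x))" if "t \<ge> 0" for t x
  proof -
    have "\<phi> t x = exp (2 * L * t) *\<^sub>R P x (Y x) t"
      using \<Theta>[of x "Y x" t] Y[of x] that by (simp add: \<phi>_def)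
    then show ?thesis by (simp add: P_def exp_minus G_def[abs_def] \<phi>_def)
  qed
  have cont\<phi>: "continuous_on S (\<lambda>s. F (\<phi> s x))" for S x
    using contG[of S "Y x"] by (simp add: G_def[abs_def] \<phi>_def)
  show thesis
  proof
    show "\<phi> 0 x = x" for x using \<phi>_eq[of 0 x] by simp
    fix x and t :: real assume t: "t \<ge> 0"
    have "((\<lambda>u. x + integral {0..u} (\<lambda>s. F (\<phi> s x))) has_vector_derivative 0 + F (\<phi> t x)) (at t within {0..t+1})"
      using t by (intro has_vector_derivative_add integral_has_vector_derivative cont\<phi>) auto
    moreover have "at t within {0..t+1} = at t within {0..}"
      using t by (intro at_within_nhd[of _ "{..<t+1}"]) auto
    ultimately have "((\<lambda>u. x + integral {0..u} (\<lambda>s. F (\<phi> s x))) has_vector_derivative F (\<phi> t x)) (at t within {0..})"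
      by simp
    then show "((\<lambda>t. \<phi> t x) has_vector_derivative F (\<phi> t x)) (at t within {0..})"
      by (rule has_vector_derivative_transform[rotated 2]) (use t \<phi>_eq in auto)
  next
    fix x y and t :: real assume t: "t \<ge> 0"
    have "dist (Y x) (Y y) \<le> 2 * norm (x - y)" using \<Theta>lip[of x "Y x" y "Y y"] Y by simp
    then have "norm (Y x t - Y y t) \<le> 2 * norm (x - y)"
      using dist_bounded[of "Y x" t "Y y"] by (simp add: dist_norm)
    then show "norm (\<phi> t x - \<phi> t y) \<le> 2 * exp (2 * L * t) * norm (x - y)"
      by (simp add: \<phi>_def mult.commute flip: scaleR_diff_right)
  qed
qed

text \<open>A diagonal extraction handles the countably many pairs of an index and a rational time;
  the Lipschitz bound, uniform in \<open>n\<close> though not in \<open>i\<close>, carries the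
  Cauchy property to all times. The free countable index type later lets hitting times join the
  modes as constant functions.\<close>

lemma equi_lipschitz_subsequence:
  fixes f :: "nat \<Rightarrow> 'i::countable \<Rightarrow> real \<Rightarrow> real"
  assumes bd: "\<And>n i t. t \<ge> 0 \<Longrightarrow> \<bar>f n i t\<bar> \<le> M"
    and lip: "\<And>n i s t. s \<ge> 0 \<Longrightarrow> t \<ge> 0 \<Longrightarrow> \<bar>f n i t - f n i s\<bar> \<le> L i * \<bar>t - s\<bar>"
  obtains r :: "nat \<Rightarrow> nat" and g where "strict_mono r"
    "\<And>i t. t \<ge> 0 \<Longrightarrow> (\<lambda>n. f (r n) i t) \<longlonglongrightarrow> g i t"
proof -
  define Q :: "('i \<times> real) set" where "Q = UNIV \<times> (\<rat> \<inter> {0..})"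
  have "countable Q" unfolding Q_def
    by (intro countable_SIGMA countable_Int1 countable_rat) auto
  moreover have "norm (case x of (i, t) \<Rightarrow> f n i t) \<le> M" if "x \<in> Q" for n x
    using that bd by (auto simp: Q_def)
  ultimately obtain r :: "nat \<Rightarrow> nat" where r: "strict_mono r"
    and c: "\<And>x. x \<in> Q \<Longrightarrow> \<exists>l. (\<lambda>n. case x of (i, t) \<Rightarrow> f (r n) i t) \<longlonglongrightarrow> l"
    using function_convergent_subsequence[of Q "\<lambda>n (i, t). f n i t" M] by blast
  have "convergent (\<lambda>n. f (r n) i t)" if t: "t \<ge> 0" for i t
    unfolding Cauchy_convergent_iff[symmetric]
  proof (rule metric_CauchyI)
    fix e :: real assume e: "e > 0"
    have Lp: "\<bar>L i\<bar> + 1 > 0" by linarith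
    obtain q where q: "q \<in> \<rat>" "t < q" "q < t + e / (3 * (\<bar>L i\<bar> + 1))"
      using Rats_dense_in_real[of t "t + e / (3 * (\<bar>L i\<bar> + 1))"] e Lp by auto
    have "(i, q) \<in> Q" using q t by (auto simp: Q_def)
    then have "Cauchy (\<lambda>n. f (r n) i q)" using c LIMSEQ_imp_Cauchy by fastforce
    then obtain N where N: "\<And>m n. m \<ge> N \<Longrightarrow> n \<ge> N \<Longrightarrow> \<bar>f (r m) i q - f (r n) i q\<bar> < e / 3"
      using metric_CauchyD[of _ "e / 3"] e by (metis dist_real_def zero_less_divide_iff zero_less_numeral)
    have near: "\<bar>f n i q - f n i t\<bar> \<le> e / 3" for n
    proof -
      have "\<bar>f n i q - f n i t\<bar> \<le> L i * \<bar>q - t\<bar>" using lip[of t q n i] t q by auto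
      also have "\<dots> \<le> (\<bar>L i\<bar> + 1) * (e / (3 * (\<bar>L i\<bar> + 1)))"
        using q by (intro mult_mono) auto
      also have "\<dots> = e / 3" using Lp by (simp add: field_simps)
      finally show ?thesis .
    qed
    have "dist (f (r m) i t) (f (r n) i t) < e" if "m \<ge> N" "n \<ge> N" for m n
      using N[OF that] near[of "r m"] near[of "r n"] unfolding dist_real_def by arith
    then show "\<exists>N. \<forall>m\<ge>N. \<forall>n\<ge>N. dist (f (r m) i t) (f (r n) i t) < e" by blast
  qed
  then have "\<And>i t. t \<ge> 0 \<Longrightarrow> (\<lambda>n. f (r n) i t) \<longlonglongrightarrow> lim (\<lambda>n. f (r n) i t)"
    by (simp add: convergent_LIMSEQ_iff)
  with r show thesis using that[of r "\<lambda>i t. lim (\<lambda>n. f (r n) i t)"] by blast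
qed

section \<open>Comparison principles for scalar differential inequalities\<close>

lemma nonincreasing_on_halfline:
  fixes u :: "real \<Rightarrow> real"
  assumes "\<And>t. t \<ge> T \<Longrightarrow> (u has_real_derivative u' t) (at t within {T..})"
    and "\<And>t. t \<ge> T \<Longrightarrow> u' t \<le> 0" and "T \<le> t"
  shows "u t \<le> u T"
proof (cases "T = t")
  case False
  have "\<exists>z\<in>{T<..<t}. u t - u T = u' z * (t - T)"
  proof (rule mvt_simple)
    show "T < t" using False assms by simp
    fix x assume "T \<le> x" "x \<le> t"
    then show "(u has_derivative (*) (u' x)) (at x within {T..t})"
      using assms(1)[of x] DERIV_subset[of u _ x "{T..}" "{T..t}"]
      by (auto simp: has_field_derivative_def)
  qed
  then obtain z where "z \<in> {T<..<t}" "u t - u T = u' z * (t - T)" by blast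
  then show ?thesis using assms(2)[of z] assms(3) mult_nonpos_nonneg[of "u' z" "t - T"] by simp
qed simp

lemma exp_comparison:
  fixes u :: "real \<Rightarrow> real"
  assumes d: "\<And>t. t \<ge> T \<Longrightarrow> (u has_real_derivative u' t) (at t within {T..})"
    and le: "\<And>t. t \<ge> T \<Longrightarrow> u' t \<le> - c * (u t - B)" and "T \<le> t"
  shows "u t - B \<le> (u T - B) * exp (- c * (t - T))"
proof -
  have "(u t - B) * exp (c * (t - T)) \<le> (u T - B) * exp (c * (T - T))"
  proof (rule nonincreasing_on_halfline[OF _ _ \<open>T \<le> t\<close>])
    fix t assume "t \<ge> T"
    then show "((\<lambda>t. (u t - B) * exp (c * (t - T))) has_real_derivative
       (u' t + c * (u t - B)) * exp (c * (t - T))) (at t within {T..})"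
      by (auto intro!: derivative_eq_intros d simp: algebra_simps)
    show "(u' t + c * (u t - B)) * exp (c * (t - T)) \<le> 0"
      using le[OF \<open>t \<ge> T\<close>] by (intro mult_nonpos_nonneg) auto
  qed
  then have "(u t - B) * exp (c * (t - T)) * exp (- c * (t - T)) \<le> (u T - B) * exp (- c * (t - T))"
    by (intro mult_right_mono) auto
  then show ?thesis by (simp add: mult.assoc flip: exp_add)
qed

lemma barrier_upper:
  fixes u :: "real \<Rightarrow> real"
  assumes "\<And>t. t \<ge> T \<Longrightarrow> (u has_real_derivative u' t) (at t within {T..})"
    and "\<And>t. t \<ge> T \<Longrightarrow> u' t \<le> - c * (u t - B)" and "u T \<le> B" "T \<le> t"
  shows "u t \<le> B"
  using exp_comparison[of T u u' c B t] assms mult_nonpos_nonneg[of "u T - B" "exp (- c * (t - T))"]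
  by simp

text \<open>After the last time before \<open>t\<close> with \<open>u \<ge> 0\<close> the function
  is negative, hence has nonnegative slope, and the mean value theorem forbids it to have dropped.
  Only the sign of \<open>u'\<close> where the barrier is violated is needed, with no rate.\<close>

lemma barrier_nonneg:
  fixes u :: "real \<Rightarrow> real"
  assumes d: "\<And>t. t \<ge> 0 \<Longrightarrow> (u has_real_derivative u' t) (at t within {0..})"
    and ge: "\<And>t. t \<ge> 0 \<Longrightarrow> u t < 0 \<Longrightarrow> u' t \<ge> 0" and "u 0 \<ge> 0" "t \<ge> 0"
  shows "u t \<ge> 0"
proof (rule ccontr)
  assume neg: "\<not> u t \<ge> 0"
  have cont: "continuous_on {0..t} u"
    by (rule DERIV_continuous_on[of _ _ u']) (meson DERIV_subset d atLeastAtMost_iff atLeast_iff subsetI)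
  define S where "S = {0..t} \<inter> u -` {0..}"
  have "compact S" unfolding S_def
    by (intro compact_eq_bounded_closed[THEN iffD2] conjI continuous_closed_preimage cont)
       (auto intro: bounded_subset[of "{0..t}"])
  moreover have "S \<noteq> {}" using assms by (auto simp: S_def)
  ultimately obtain s where s: "s \<in> S" "\<And>x. x \<in> S \<Longrightarrow> x \<le> s"
    using compact_attains_sup by metis
  have st: "0 \<le> s" "s < t" "u s \<ge> 0" using s(1) neg by (auto simp: S_def less_le)
  have "\<exists>z\<in>{s<..<t}. u t - u s = u' z * (t - s)"
  proof (rule mvt_simple)
    fix x assume "s \<le> x" "x \<le> t"
    then show "(u has_derivative (*) (u' x)) (at x within {s..t})"
      using d[of x] DERIV_subset[of u _ x "{0..}" "{s..t}"] st
      by (auto simp: has_field_derivative_def)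
  qed fact
  then obtain z where z: "z \<in> {s<..<t}" "u t - u s = u' z * (t - s)" by blast
  then have "z \<notin> S" using s(2)[of z] by auto
  then have "u z < 0" using z st by (auto simp: S_def)
  then have "u' z * (t - s) \<ge> 0" using ge[of z] z st by simp
  with z st neg show False by linarith
qed

section \<open>Clamping, and sequences as bounded functions\<close>

text \<open>Projection onto \<open>[0, R]\<close>. It makes the quadratic right-hand side globally
  Lipschitz, so that the global flow exists; a priori bounds then show that it never acts on the
  solution.\<close>

definition clamp_to :: "real \<Rightarrow> real \<Rightarrow> real" where
  "clamp_to R x = max 0 (min R x)"

lemma clamp_to_bounds: "R \<ge> 0 \<Longrightarrow> 0 \<le> clamp_to R x" "R \<ge> 0 \<Longrightarrow> \<bar>clamp_to R x\<bar> \<le> R"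
  by (auto simp: clamp_to_def)

lemma clamp_to_le: "0 \<le> x \<Longrightarrow> clamp_to R x \<le> x"
  by (auto simp: clamp_to_def)

lemma clamp_to_eq: "0 \<le> x \<Longrightarrow> x \<le> R \<Longrightarrow> clamp_to R x = x"
  by (auto simp: clamp_to_def)

lemma clamp_to_lipschitz: "\<bar>clamp_to R x - clamp_to R y\<bar> \<le> \<bar>x - y\<bar>"
  by (auto simp: clamp_to_def max_def min_def)

lemma abs_mult_diff_le:
  fixes x y x' y' R D :: real
  assumes "\<bar>x - x'\<bar> \<le> D" "\<bar>y - y'\<bar> \<le> E" "\<bar>y\<bar> \<le> R" "\<bar>x'\<bar> \<le> R"
  shows "\<bar>x * y - x' * y'\<bar> \<le> R * (D + E)"
proof -
  have "x * y - x' * y' = (x - x') * y + x' * (y - y')" by (simp add: algebra_simps)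
  also have "\<bar>\<dots>\<bar> \<le> \<bar>x - x'\<bar> * \<bar>y\<bar> + \<bar>x'\<bar> * \<bar>y - y'\<bar>"
    by (metis abs_mult abs_triangle_ineq)
  also have "\<dots> \<le> D * R + R * E" using assms by (intro add_mono mult_mono) auto
  finally show ?thesis by (simp add: algebra_simps)
qed

instance bcontfun :: (metric_space, banach) banach ..

lemma bounded_linear_apply_bcontfun:
  "bounded_linear (\<lambda>f :: 'a::topological_space \<Rightarrow>\<^sub>C 'b::real_normed_vector. apply_bcontfun f x)"
  by (rule bounded_linear_intro[of _ 1])
     (auto simp: plus_bcontfun.rep_eq scaleR_bcontfun.rep_eq norm_bounded)

text \<open>On a discrete space continuity is free, so \<open>nat discrete\<close> turns bounded
  continuous functions into the Banach space of bounded sequences, the state space of the flow. Data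
  and vector field of the truncated system have finite support.\<close>

lemma finite_support_bcontfun:
  fixes f :: "'i \<Rightarrow> 'a::real_normed_vector"
  assumes "finite S" "\<And>i. i \<notin> S \<Longrightarrow> f i = 0"
  shows "(\<lambda>i. f (of_discrete i)) \<in> bcontfun"
proof -
  have "range (\<lambda>i. f (of_discrete i)) \<subseteq> insert 0 (f ` S)" using assms by force
  then have "finite (range (\<lambda>i. f (of_discrete i)))" by (rule finite_subset) (use assms in simp)
  moreover have "continuous_on UNIV (\<lambda>i. f (of_discrete i))"
    by (simp add: continuous_on_open_vimage open_discrete)
  ultimately show ?thesis by (simp add: bcontfun_def finite_imp_bounded)
qed

lemma has_real_derivative_quadratic_bound:
  fixes f :: "real \<Rightarrow> real"
  assumes "\<And>t. t \<in> S \<Longrightarrow> \<bar>f t - f s - D * (t - s)\<bar> \<le> E * (t - s)\<^sup>2"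
  shows "(f has_real_derivative D) (at s within S)"
  unfolding has_field_derivative_iff
proof (rule Lim_transform_within[OF _ zero_less_one])
  have "((\<lambda>t. (f t - f s) / (t - s) - D) \<longlongrightarrow> 0) (at s within S)"
  proof (rule Lim_null_comparison)
    show "\<forall>\<^sub>F t in at s within S. norm ((f t - f s) / (t - s) - D) \<le> E * \<bar>t - s\<bar>"
      unfolding eventually_at_filter
    proof (intro always_eventually allI impI)
      fix t assume t: "t \<noteq> s" "t \<in> S"
      have "(f t - f s) / (t - s) - D = (f t - f s - D * (t - s)) / (t - s)"
        using t by (simp add: diff_divide_distrib)
      then have "\<bar>(f t - f s) / (t - s) - D\<bar> = \<bar>f t - f s - D * (t - s)\<bar> / \<bar>t - s\<bar>"
        by (simp only: abs_divide)
      also have "\<dots> \<le> E * (t - s)\<^sup>2 / \<bar>t - s\<bar>" using assms[OF t(2)] by (intro divide_right_mono) auto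
      also have "(t - s)\<^sup>2 = \<bar>t - s\<bar> * \<bar>t - s\<bar>" by (simp add: power2_eq_square)
      also have "E * (\<bar>t - s\<bar> * \<bar>t - s\<bar>) / \<bar>t - s\<bar> = E * \<bar>t - s\<bar>" using t by (simp del: abs_mult_self_eq)
      finally show "norm ((f t - f s) / (t - s) - D) \<le> E * \<bar>t - s\<bar>" by simp
    qed
    have "((\<lambda>t. E * \<bar>t - s\<bar>) \<longlongrightarrow> E * \<bar>s - s\<bar>) (at s within S)" by (intro tendsto_intros)
    then show "((\<lambda>t. E * \<bar>t - s\<bar>) \<longlongrightarrow> 0) (at s within S)" by simp
  qed
  then show "((\<lambda>t. (f t - f s) / (t - s)) \<longlongrightarrow> D) (at s within S)" by (rule LIM_zero_cancel)
qed simp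

subsection \<open>The truncated system\<close>

text \<open>With \<open>a\<^sub>k = N\<^sub>k\<^bsup>\<alpha>-2\<^esup> X\<^sub>k\<close> and \<open>\<mu> = lam\<^bsup>4-2\<alpha>\<^esup>\<close> the system becomes
  \<open>a\<^sub>k' = N\<^sub>k\<^sup>2 (- \<nu> a\<^sub>k + \<mu> a\<^sub>k\<^sub>+\<^sub>1\<^sup>2 - lam\<^bsup>-2\<^esup> a\<^sub>k\<^sub>-\<^sub>1 a\<^sub>k)\<close>, and the hypotheses on \<open>lam\<close> and \<open>\<alpha>\<close> enter only
  through \<open>lam > 2\<close> and \<open>\<mu> > 4\<close>.\<close>

locale scaled_dyadic =
  fixes \<nu> lam \<mu> :: real
  assumes nu_pos: "\<nu> > 0" and lam_gt: "lam > 2" and mu_gt: "\<mu> > 4"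
begin

definition w :: "nat \<Rightarrow> real" where "w k = lam ^ (2 * k)"

definition rhs :: "(nat \<Rightarrow> real) \<Rightarrow> nat \<Rightarrow> real" where
  "rhs x k = w k * (- \<nu> * x k + \<mu> * (x (k + 1))\<^sup>2 - x (k - 1) * x k / lam\<^sup>2)"

text \<open>Nonnegativity is built in because the comparison arguments discard the loss term
  \<open>a_(k-1) a_k\<close> by its sign.\<close>

definition truncated_solution :: "nat \<Rightarrow> real \<Rightarrow> (real \<Rightarrow> nat \<Rightarrow> real) \<Rightarrow> bool" where
  "truncated_solution n A a \<longleftrightarrow>
     (\<forall>t\<ge>0. a t 0 = 0) \<and> (\<forall>t\<ge>0. \<forall>k>n. a t k = 0) \<and> (\<forall>t\<ge>0. \<forall>k. a t k \<ge> 0) \<and>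
     (\<forall>k. a 0 k = (if k = n then A else 0)) \<and>
     (\<forall>k\<in>{1..n}. \<forall>t\<ge>0. ((\<lambda>t. a t k) has_real_derivative rhs (a t) k) (at t within {0..}))"

lemma w_pos: "w k > 0" using lam_gt by (simp add: w_def)

lemma w_mono: "j \<le> k \<Longrightarrow> w j \<le> w k"
  unfolding w_def using lam_gt by (intro power_increasing) auto

lemma w_Suc: "w (Suc k) = lam\<^sup>2 * w k"
  by (simp add: w_def power_add power2_eq_square)

lemma lam2_gt: "lam\<^sup>2 > 4"
  using lam_gt power_strict_mono[of 2 lam 2] by simp

text \<open>\<open>D\<close> is asked only for indices up to \<open>k + 1\<close>, because the time
  increments to which this is applied grow with the index.\<close>

lemma rhs_lipschitz:
  assumes x: "\<And>j. \<bar>x j\<bar> \<le> M" and y: "\<And>j. \<bar>y j\<bar> \<le> M"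
    and D: "\<And>j. j \<le> k + 1 \<Longrightarrow> \<bar>x j - y j\<bar> \<le> D"
  shows "\<bar>rhs x k - rhs y k\<bar> \<le> w k * (\<nu> + 2 * \<mu> * M + 2 * M) * D"
proof -
  have D0: "D \<ge> 0" and M0: "M \<ge> 0" using D[of 0] x[of 0] by linarith+
  have sq: "\<bar>\<mu> * (x (k + 1))\<^sup>2 - \<mu> * (y (k + 1))\<^sup>2\<bar> \<le> \<mu> * (M * (D + D))"
    using abs_mult_diff_le[OF D D x y, of "k+1" "k+1"] mu_gt
    by (simp add: power2_eq_square abs_mult flip: right_diff_distrib)
  have "\<bar>x (k - 1) * x k / lam\<^sup>2 - y (k - 1) * y k / lam\<^sup>2\<bar> = \<bar>x (k - 1) * x k - y (k - 1) * y k\<bar> / lam\<^sup>2"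
    by (simp add: abs_divide flip: diff_divide_distrib)
  also have "\<dots> \<le> M * (D + D) / 1"
    using abs_mult_diff_le[OF D D x y, of "k-1" k] lam2_gt M0 D0 by (intro frac_le) auto
  finally have pr: "\<bar>x (k - 1) * x k / lam\<^sup>2 - y (k - 1) * y k / lam\<^sup>2\<bar> \<le> M * (D + D)" by simp
  have li: "\<bar>\<nu> * x k - \<nu> * y k\<bar> \<le> \<nu> * D"
    using nu_pos D[of k] by (simp add: abs_mult flip: right_diff_distrib)
  have "\<bar>rhs x k - rhs y k\<bar> = w k * \<bar>- (\<nu> * x k - \<nu> * y k) + (\<mu> * (x (k + 1))\<^sup>2 - \<mu> * (y (k + 1))\<^sup>2)
     - (x (k - 1) * x k / lam\<^sup>2 - y (k - 1) * y k / lam\<^sup>2)\<bar>"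
    using w_pos[of k] unfolding rhs_def
    by (simp add: abs_mult flip: right_diff_distrib) (simp add: algebra_simps)
  also have "\<dots> \<le> w k * (\<nu> * D + \<mu> * (M * (D + D)) + M * (D + D))"
    using sq pr li w_pos[of k] by (intro mult_left_mono) linarith+
  finally show ?thesis by (simp add: algebra_simps)
qed

text \<open>The clamped system is solved globally, and its solutions are shown to stay in
  \<open>[0, R]\<close>. The bound \<open>R\<close> depends on \<open>n\<close>, which is harmless
  here. Lipschitz dependence on the amplitude is included because the tuning rests on it.\<close>

lemma truncated_solutions_exist:
  assumes n: "n \<ge> 1" and A1: "A1 \<ge> 0"
  shows "\<exists>a L. (\<forall>A\<in>{0..A1}. truncated_solution n A (a A)) \<and>
    (\<forall>A B. \<forall>t\<ge>0. \<forall>k. \<bar>a A t k - a B t k\<bar> \<le> 2 * exp (2 * L * t) * \<bar>A - B\<bar>)"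
proof -
  \<comment> \<open>Bounds from the top mode downwards: mode \<open>n\<close> is not fed and stays
    below \<open>A1\<close>; a mode fed by at most \<open>\<mu> (b j)^2\<close> cannot grow above
    \<open>\<mu> (b j)^2 / \<nu>\<close>. The extra summand makes \<open>b\<close> increasing, so
    that \<open>b n\<close> bounds all modes.\<close>
  define b where "b = rec_nat A1 (\<lambda>_ x. x + \<mu> * x\<^sup>2 / \<nu>)"
  have b0: "b 0 = A1" and bS: "b (Suc j) = b j + \<mu> * (b j)\<^sup>2 / \<nu>" for j by (simp_all add: b_def)
  have b_step: "b j \<le> b (Suc j)" for j using nu_pos mu_gt by (simp add: bS)
  then have b_mono: "b i \<le> b j" if "i \<le> j" for i j using that by (rule lift_Suc_mono_le)
  have b_nonneg: "b j \<ge> 0" for j using b_mono[of 0 j] b0 A1 by simp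
  define R where "R = b n"
  have R: "R \<ge> 0" by (simp add: R_def b_nonneg)
  let ?c = "clamp_to R"
  define f where "f x k = (if 1 \<le> k \<and> k \<le> n then rhs (\<lambda>j. ?c (x j)) k else 0)"
    for x :: "nat \<Rightarrow> real" and k
  define L where "L = w n * (\<nu> + 2 * \<mu> * R + 2 * R)"
  have Lpos: "L > 0" unfolding L_def using nu_pos mu_gt R w_pos[of n]
    by (intro mult_pos_pos add_pos_nonneg) auto
  have f_lip: "\<bar>f x k - f y k\<bar> \<le> L * D" if D: "\<And>j. \<bar>x j - y j\<bar> \<le> D" for x y k D
  proof (cases "1 \<le> k \<and> k \<le> n")
    case True
    have "\<bar>f x k - f y k\<bar> \<le> w k * (\<nu> + 2 * \<mu> * R + 2 * R) * D"
      unfolding f_def using True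
      by (simp only: if_True simp_thms)
         (intro rhs_lipschitz clamp_to_bounds R order_trans[OF clamp_to_lipschitz D])
    also have "\<dots> \<le> L * D"
      unfolding L_def using True R D[of 0] nu_pos mu_gt by (intro mult_right_mono w_mono) auto
    finally show ?thesis .
  next
    case False
    then show ?thesis using Lpos D[of 0] by (auto simp: f_def)
  qed
  define ev where "ev x k = apply_bcontfun x (discrete k)" for x :: "nat discrete \<Rightarrow>\<^sub>C real" and k
  have ev_diff: "\<bar>ev x k - ev y k\<bar> \<le> norm (x - y)" for x y k
    using norm_bounded[of "x - y" "discrete k"] by (simp add: ev_def)
  have norm_leI: "norm (x - y) \<le> D" if "\<And>k. \<bar>ev x k - ev y k\<bar> \<le> D" for x y D
    using that by (intro norm_bound) (simp add: ev_def, metis of_discrete_inverse)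
  define F where "F x = Bcontfun (\<lambda>i. f (ev x) (of_discrete i))" for x
  have F: "ev (F x) k = f (ev x) k" for x k
    unfolding F_def ev_def[of "Bcontfun _"]
    by (subst Bcontfun_inverse) (auto intro!: finite_support_bcontfun[of "{..n}"] simp: f_def discrete_inverse split: if_splits)
  have F_lip: "norm (F x - F y) \<le> L * norm (x - y)" for x y
    by (intro norm_leI) (simp add: F f_lip ev_diff)
  obtain \<phi> where \<phi>0: "\<And>x. \<phi> 0 x = x"
    and \<phi>': "\<And>x t. t \<ge> 0 \<Longrightarrow> ((\<lambda>t. \<phi> t x) has_vector_derivative F (\<phi> t x)) (at t within {0..})"
    and \<phi>_lip: "\<And>x y t. t \<ge> 0 \<Longrightarrow> norm (\<phi> t x - \<phi> t y) \<le> 2 * exp (2 * L * t) * norm (x - y)"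
  proof (rule lipschitz_global_flow[OF F_lip Lpos])
    fix \<psi> assume "\<And>x. \<psi> 0 x = x"
      "\<And>x t. t \<ge> 0 \<Longrightarrow> ((\<lambda>t. \<psi> t x) has_vector_derivative F (\<psi> t x)) (at t within {0..})"
      "\<And>x y t. t \<ge> 0 \<Longrightarrow> norm (\<psi> t x - \<psi> t y) \<le> 2 * exp (2 * L * t) * norm (x - y)"
    then show thesis by (rule that[of \<psi>])
  qed
  define e where "e A = Bcontfun (\<lambda>i. if of_discrete i = n then A else 0)" for A :: real
  have e: "ev (e A) k = (if k = n then A else 0)" for A k
    unfolding e_def ev_def
    by (subst Bcontfun_inverse)
       (auto intro!: finite_support_bcontfun[of "{n}" "\<lambda>i. if i = n then A else 0"] simp: discrete_inverse split: if_splits)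
  have e_diff: "norm (e A - e B) \<le> \<bar>A - B\<bar>" for A B
    by (rule norm_leI) (simp add: e)
  define a where "a A t k = ev (\<phi> t (e A)) k" for A t k
  have a0: "a A 0 k = (if k = n then A else 0)" for A k by (simp add: a_def \<phi>0 e)
  have a': "((\<lambda>t. a A t k) has_real_derivative f (a A t) k) (at t within {0..})" if "t \<ge> 0" for A t k
    using bounded_linear.has_vector_derivative[OF bounded_linear_apply_bcontfun \<phi>'[OF that]]
    unfolding has_real_derivative_iff_has_vector_derivative a_def F[symmetric] unfolding ev_def by simp
  show ?thesis
  proof (intro exI[of _ a] exI[of _ L] conjI ballI allI impI)
    fix A B t k assume t: "(t::real) \<ge> 0"
    have "\<bar>a A t k - a B t k\<bar> \<le> norm (\<phi> t (e A) - \<phi> t (e B))"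
      by (simp add: a_def ev_diff)
    also have "\<dots> \<le> 2 * exp (2 * L * t) * norm (e A - e B)" by (rule \<phi>_lip[OF t])
    also have "\<dots> \<le> 2 * exp (2 * L * t) * \<bar>A - B\<bar>" by (intro mult_left_mono e_diff) auto
    finally show "\<bar>a A t k - a B t k\<bar> \<le> 2 * exp (2 * L * t) * \<bar>A - B\<bar>" .
  next
    fix A assume A: "A \<in> {0..A1}"
    have zero: "a A t k = 0" if t: "t \<ge> 0" and k: "k = 0 \<or> k > n" for t k
    proof -
      have fz: "f x k = 0" for x using k n by (auto simp: f_def)
      have d: "((\<lambda>t. a A t k) has_real_derivative 0) (at t within {0..})" if "t \<ge> 0" for t
        using a'[OF that, of A k] by (simp only: fz)
      have "a A t k \<le> a A 0 k"
        using t d by (rule nonincreasing_on_halfline[where u'="\<lambda>_. 0", rotated 2]) auto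
      moreover have "- a A t k \<le> - a A 0 k"
      proof (rule nonincreasing_on_halfline[where u'="\<lambda>_. 0", OF _ _ t])
        show "((\<lambda>t. - a A t k) has_real_derivative 0) (at t within {0..})" if "t \<ge> 0" for t
          using DERIV_minus[OF d[OF that]] by simp
      qed simp
      moreover have "a A 0 k = 0" using k n by (auto simp: a0)
      ultimately show ?thesis by simp
    qed
    have nonneg: "a A t k \<ge> 0" if t: "t \<ge> 0" for t k
    proof (rule barrier_nonneg[OF a' _ _ t])
      show "0 \<le> a A 0 k" using A by (simp add: a0)
      fix t :: real assume t: "t \<ge> 0" and neg: "a A t k < 0"
      \<comment> \<open>Where the mode is negative its clamped value vanishes, removing damping and
        loss; only the nonnegative feed remains.\<close>
      then have "?c (a A t k) = 0" using R by (simp add: clamp_to_def)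
      then show "f (a A t) k \<ge> 0"
        using mu_gt w_pos[of k] by (simp add: f_def rhs_def)
    qed auto
    have bound: "a A t (n - j) \<le> b j" if "j \<le> n" "t \<ge> 0" for j t
      using that
    proof (induction j arbitrary: t)
      case 0
      have "b 0 - a A t n \<ge> 0"
      proof (rule barrier_nonneg[where u = "\<lambda>t. b 0 - a A t n" and u' = "\<lambda>t. - f (a A t) n"])
        show "0 \<le> b 0 - a A 0 n" using A by (simp add: a0 b0)
        fix t :: real assume t: "t \<ge> 0"
        show "((\<lambda>t. b 0 - a A t n) has_real_derivative - f (a A t) n) (at t within {0..})"
          by (auto intro!: derivative_eq_intros a' t)
        have "?c (a A t (n + 1)) = 0" using zero[OF t] R by (simp add: clamp_to_def)
        moreover have "\<nu> * ?c (a A t n) \<ge> 0" "?c (a A t (n - 1)) * ?c (a A t n) / lam\<^sup>2 \<ge> 0"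
          using nu_pos by (simp_all add: clamp_to_bounds R)
        ultimately show "0 \<le> - f (a A t) n"
          using n w_pos[of n] by (simp add: f_def rhs_def mult_nonneg_nonpos)
      qed fact
      then show ?case by simp
    next
      case (Suc j)
      let ?k = "n - Suc j"
      show ?case
      proof (cases "?k = 0")
        case True
        then show ?thesis using zero[of t 0] Suc.prems b_nonneg by simp
      next
        case False
        have k1: "Suc ?k = n - j" using False by simp
        have "b (Suc j) - a A t ?k \<ge> 0"
        proof (rule barrier_nonneg[where u = "\<lambda>t. b (Suc j) - a A t ?k" and u' = "\<lambda>t. - f (a A t) ?k"])
          show "0 \<le> b (Suc j) - a A 0 ?k"
          proof -
            have "?k \<noteq> n" using False by arith
            then show ?thesis using b_nonneg[of "Suc j"] a0[of A ?k] by simp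
          qed
          fix t :: real assume t: "t \<ge> 0"
          show "((\<lambda>t. b (Suc j) - a A t ?k) has_real_derivative - f (a A t) ?k) (at t within {0..})"
            by (auto intro!: derivative_eq_intros a' t)
          assume "b (Suc j) - a A t ?k < 0"
          \<comment> \<open>The barrier does not exceed the cut-off \<open>R\<close>, so clamping
            cannot push the value below it.\<close>
          then have "?c (a A t ?k) \<ge> b (Suc j)"
            using b_mono[of "Suc j" n] Suc.prems by (simp add: clamp_to_def R_def)
          then have low: "\<nu> * ?c (a A t ?k) \<ge> \<nu> * b (Suc j)" using nu_pos by simp
          have "?c (a A t (n - j)) \<le> b j"
            using clamp_to_le[OF nonneg[OF t]] Suc.IH[of t] Suc.prems t order_trans by fastforce
          then have "(?c (a A t (n - j)))\<^sup>2 \<le> (b j)\<^sup>2"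
            using clamp_to_bounds[OF R] by (intro power_mono) auto
          then have sq: "\<mu> * (?c (a A t (n - j)))\<^sup>2 \<le> \<mu> * (b j)\<^sup>2" using mu_gt by simp
          have "\<nu> * b (Suc j) \<ge> \<mu> * (b j)\<^sup>2"
            using nu_pos b_nonneg[of j] by (simp add: bS distrib_left)
          moreover have "?c (a A t (?k - 1)) * ?c (a A t ?k) / lam\<^sup>2 \<ge> 0"
            by (simp add: clamp_to_bounds R)
          ultimately have "- \<nu> * ?c (a A t ?k) + \<mu> * (?c (a A t (n - j)))\<^sup>2
              - ?c (a A t (?k - 1)) * ?c (a A t ?k) / lam\<^sup>2 \<le> 0"
            using low sq by linarith
          then show "0 \<le> - f (a A t) ?k"
            using w_pos[of ?k] False unfolding f_def rhs_def
            by (simp add: k1 mult_nonneg_nonpos)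
        qed fact
        then show ?thesis by simp
      qed
    qed
    have le_R: "a A t k \<le> R" if t: "t \<ge> 0" for t k
    proof (cases "k \<le> n")
      case True
      then show ?thesis using bound[of "n - k" t] t b_mono[of "n - k" n] by (simp add: R_def)
    next
      case False
      then show ?thesis using zero[OF t] R by simp
    qed
    have f_rhs: "f (a A t) k = rhs (a A t) k" if "k \<in> {1..n}" "t \<ge> 0" for t k
      using that by (simp add: f_def rhs_def clamp_to_eq nonneg le_R)
    have "((\<lambda>t. a A t k) has_real_derivative rhs (a A t) k) (at t within {0..})"
      if "k \<in> {1..n}" "t \<ge> 0" for t k
      using a'[OF that(2), of A k] unfolding f_rhs[OF that] .
    then show "truncated_solution n A (a A)"
      unfolding truncated_solution_def by (simp add: zero nonneg a0)
  qed
qed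

section \<open>A priori bounds for a truncated solution\<close>

context
  fixes n :: nat and A :: real and a :: "real \<Rightarrow> nat \<Rightarrow> real"
  assumes sol: "truncated_solution n A a"
begin

lemma truncated_0: "t \<ge> 0 \<Longrightarrow> a t 0 = 0"
  and truncated_beyond: "t \<ge> 0 \<Longrightarrow> k > n \<Longrightarrow> a t k = 0"
  and truncated_nonneg: "t \<ge> 0 \<Longrightarrow> a t k \<ge> 0"
  and truncated_initial: "a 0 k = (if k = n then A else 0)"
  using sol by (auto simp: truncated_solution_def)

lemma truncated_deriv:
  assumes "k \<in> {1..n}" "T \<ge> 0" "t \<ge> T"
  shows "((\<lambda>t. a t k) has_real_derivative rhs (a t) k) (at t within {T..})"
proof -
  have "((\<lambda>t. a t k) has_real_derivative rhs (a t) k) (at t within {0..})"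
    using sol assms by (auto simp: truncated_solution_def)
  then show ?thesis by (rule DERIV_subset) (use assms in auto)
qed

lemma rhs_upper:
  assumes t: "t \<ge> 0" and B: "a t (k + 1) \<le> B"
  shows "rhs (a t) k \<le> w k * (- \<nu> * a t k + \<mu> * B\<^sup>2)"
proof -
  have "(a t (k + 1))\<^sup>2 \<le> B\<^sup>2" using B truncated_nonneg[OF t] by (intro power_mono)
  then have "\<mu> * (a t (k + 1))\<^sup>2 \<le> \<mu> * B\<^sup>2" using mu_gt by simp
  moreover have "a t (k - 1) * a t k / lam\<^sup>2 \<ge> 0" by (simp add: truncated_nonneg t)
  ultimately show ?thesis unfolding rhs_def using w_pos[of k] by (intro mult_left_mono) auto
qed

text \<open>As long as modes \<open>k - 1\<close> and \<open>k - 2\<close> stay below \<open>M\<close>, mode \<open>k\<close> decays at rate at most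
  \<open>w\<^sub>k d\<close>, hence up to time \<open>1 / (w\<^sub>k d)\<close> it feeds more than \<open>M\<close> into mode \<open>k - 1\<close>.\<close>

lemma truncated_transfer:
  assumes k: "2 \<le> k" "k \<le> n" and t0: "t\<^sub>0 \<ge> 0" and M: "M \<ge> 10 * \<nu> * lam\<^sup>2" and ak: "a t\<^sub>0 k \<ge> M"
  shows "\<exists>t\<ge>0. a t (k - 1) \<ge> M \<or> a t (k - 2) \<ge> M"
proof (rule ccontr)
  assume "\<not> ?thesis"
  then have lt: "a t (k - 1) < M" "a t (k - 2) < M" if "t \<ge> 0" for t using that by force+
  have lam0: "lam\<^sup>2 > 0" using lam2_gt by linarith
  have M0: "M > 0" using M mult_pos_pos[OF nu_pos lam0] by linarith
  define d where "d = \<nu> + M / lam\<^sup>2"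
  have d0: "d > 0" using nu_pos M0 lam0 by (simp add: d_def add_pos_pos)
  define V where "V = w (k - 1)"
  have W: "w k = lam\<^sup>2 * V" using w_Suc[of "k - 1"] k by (simp add: V_def)
  have V0: "V > 0" by (simp add: V_def w_pos)
  have W0: "w k > 0" by (rule w_pos)
  have low: "a t k \<ge> M * exp (- (w k * d) * (t - t\<^sub>0))" if t: "t \<ge> t\<^sub>0" for t
  proof -
    have "- a t k - 0 \<le> (- a t\<^sub>0 k - 0) * exp (- (w k * d) * (t - t\<^sub>0))"
    proof (rule exp_comparison[where u = "\<lambda>t. - a t k" and u' = "\<lambda>t. - rhs (a t) k", OF _ _ t])
      fix t assume t: "t \<ge> t\<^sub>0"
      show "((\<lambda>t. - a t k) has_real_derivative - rhs (a t) k) (at t within {t\<^sub>0..})"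
        using k t t0 by (intro DERIV_minus truncated_deriv) auto
      have t': "t \<ge> 0" using t t0 by simp
      have *: "a t (k - 1) * a t k / lam\<^sup>2 \<le> M * a t k / lam\<^sup>2"
        using lt(1)[OF t'] truncated_nonneg[OF t', of k] lam0
        by (intro divide_right_mono mult_right_mono) auto
      have "- d * a t k \<le> - \<nu> * a t k + \<mu> * (a t (k + 1))\<^sup>2 - a t (k - 1) * a t k / lam\<^sup>2"
      proof -
        have "- d * a t k = - \<nu> * a t k - M * a t k / lam\<^sup>2" by (simp add: d_def algebra_simps)
        moreover have "\<mu> * (a t (k + 1))\<^sup>2 \<ge> 0" using mu_gt by simp
        ultimately show ?thesis using * by linarith
      qed
      from mult_left_mono[OF this, of "w k"]
      show "- rhs (a t) k \<le> - (w k * d) * (- a t k - 0)"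
        using W0 by (simp add: rhs_def mult_ac)
    qed
    moreover have "M * exp (- (w k * d) * (t - t\<^sub>0)) \<le> a t\<^sub>0 k * exp (- (w k * d) * (t - t\<^sub>0))"
      using ak by (intro mult_right_mono) auto
    ultimately show ?thesis by (simp only: diff_0_right mult_minus_left neg_le_iff_le)
  qed
  \<comment> \<open>\<open>Q\<close> is the feed
    \<open>V * \<mu> * M^2 * exp (- 2 (w k * d) (t - t\<^sub>0))\<close> into mode
    \<open>k - 1\<close>, integrated over all later times. In \<open>h\<close> this feed and the
    largest possible loss rate \<open>V * M * d\<close> are integrated, so that \<open>h\<close>
    nonincreasing is the lower bound for mode \<open>k - 1\<close>.\<close>
  define Q where "Q = \<mu> * M\<^sup>2 / (2 * lam\<^sup>2 * d)"
  define h where "h t = - a t (k - 1) - Q * exp (- 2 * (w k * d) * (t - t\<^sub>0)) - V * M * d * (t - t\<^sub>0)" for t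
  \<comment> \<open>One decay time of mode \<open>k\<close>: the fraction
    \<open>1 - exp (- 2)\<close> of \<open>Q\<close> has arrived, while the accumulated loss is only
    \<open>M / lam^2\<close>.\<close>
  define t1 where "t1 = t\<^sub>0 + 1 / (w k * d)"
  have t1: "t1 \<ge> t\<^sub>0" using W0 d0 by (simp add: t1_def)
  have Q': "Q * (2 * (w k * d)) = V * \<mu> * M\<^sup>2" using d0 lam0 by (simp add: Q_def W field_simps)
  have "h t1 \<le> h t\<^sub>0"
  proof (rule nonincreasing_on_halfline[OF _ _ t1])
    fix t assume t: "t \<ge> t\<^sub>0"
    then have t': "t \<ge> 0" using t0 by simp
    show "(h has_real_derivative - rhs (a t) (k - 1) + Q * (2 * (w k * d)) * exp (- 2 * (w k * d) * (t - t\<^sub>0)) - V * M * d)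
        (at t within {t\<^sub>0..})"
      unfolding h_def using k t t0
      by (auto intro!: derivative_eq_intros truncated_deriv simp: algebra_simps)
    have "(M * exp (- (w k * d) * (t - t\<^sub>0)))\<^sup>2 \<le> (a t k)\<^sup>2"
      using low[OF t] M0 by (intro power_mono) auto
    then have sq: "\<mu> * (M\<^sup>2 * exp (- 2 * (w k * d) * (t - t\<^sub>0))) \<le> \<mu> * (a t k)\<^sup>2"
      using mu_gt by (simp add: power_mult_distrib mult.assoc flip: exp_double)
    have "a t (k - 2) * a t (k - 1) / lam\<^sup>2 \<le> M * M / lam\<^sup>2"
      using lt[OF t'] truncated_nonneg[OF t'] lam0 M0
      by (intro divide_right_mono mult_mono) auto
    moreover have "\<nu> * a t (k - 1) \<le> \<nu> * M" using lt(1)[OF t'] nu_pos by simp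
    moreover have "M * d = \<nu> * M + M * M / lam\<^sup>2" by (simp add: d_def distrib_left)
    ultimately have "\<mu> * (M\<^sup>2 * exp (- 2 * (w k * d) * (t - t\<^sub>0))) - M * d
        \<le> - \<nu> * a t (k - 1) + \<mu> * (a t k)\<^sup>2 - a t (k - 2) * a t (k - 1) / lam\<^sup>2"
      using sq by linarith
    from mult_left_mono[OF this, of V]
    have "V * (\<mu> * (M\<^sup>2 * exp (- 2 * (w k * d) * (t - t\<^sub>0))) - M * d) \<le> rhs (a t) (k - 1)"
      using V0 k by (simp add: rhs_def V_def numeral_2_eq_2)
    then show "- rhs (a t) (k - 1) + Q * (2 * (w k * d)) * exp (- 2 * (w k * d) * (t - t\<^sub>0)) - V * M * d \<le> 0"
      unfolding Q' by (simp add: algebra_simps)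
  qed
  moreover have "w k * d * (t1 - t\<^sub>0) = 1" using W0 d0 by (simp add: t1_def)
  then have "h t1 = - a t1 (k - 1) - Q * exp (- 2) - V * M * d * (t1 - t\<^sub>0)"
    by (simp add: h_def mult.assoc)
  moreover have "V * M * d * (t1 - t\<^sub>0) = M / lam\<^sup>2"
    using V0 d0 lam0 by (simp add: t1_def W field_simps)
  moreover have "h t\<^sub>0 \<le> - Q" using truncated_nonneg[OF t0] by (simp add: h_def)
  ultimately have "Q * (1 - exp (- 2)) - M / lam\<^sup>2 \<le> a t1 (k - 1)" by (simp add: algebra_simps)
  moreover have "a t1 (k - 1) < M" using lt(1)[of t1] t1 t0 by simp
  moreover have "M / lam\<^sup>2 \<le> M / 4" using lam2_gt M0 by (intro divide_left_mono) auto
  \<comment> \<open>\<open>M \<ge> 10 \<nu> lam^2\<close> gives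
    \<open>lam^2 d \<le> 11/10 M\<close>, so \<open>\<mu> > 4\<close> yields
    \<open>Q \<ge> 20/11 M\<close>, and \<open>exp 2 \<ge> 5\<close> leaves 4/5 of it. The surplus
    over \<open>M\<close> exceeds the loss \<open>M / 4\<close>, which is the contradiction.\<close>
  moreover have "Q * (1 - exp (- 2)) \<ge> 16/11 * M"
  proof -
    have "exp (2::real) \<ge> 5" using exp_lower_Taylor_quadratic[of 2] by simp
    then have "exp (- 2 :: real) \<le> 1 / 5" by (simp add: exp_minus field_simps)
    then have e: "1 - exp (- 2 :: real) \<ge> 4 / 5" by linarith
    have "lam\<^sup>2 * d \<le> 11/10 * M" using M lam0 by (simp add: d_def distrib_left mult_ac)
    then have "4 * M\<^sup>2 / (2 * (11/10 * M)) \<le> \<mu> * M\<^sup>2 / (2 * (lam\<^sup>2 * d))"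
      using mu_gt lam0 d0 M0 by (intro frac_le mult_right_mono mult_left_mono) auto
    then have "Q \<ge> 20/11 * M" using M0 by (simp add: Q_def power2_eq_square mult.assoc)
    with e have "Q * (1 - exp (- 2)) \<ge> (20/11 * M) * (4 / 5)" using M0 by (intro mult_mono) auto
    then show ?thesis by simp
  qed
  ultimately show False using M0 by linarith
qed

text \<open>Each transfer lowers the index by one or two and cannot land on the vanishing mode
  \<open>0\<close>, as \<open>M > 0\<close>. \<open>M\<close> stays free so that a value strictly
  above \<open>level\<close> can be transported unchanged.\<close>

lemma truncated_reaches_first:
  assumes "k \<in> {1..n}" "t\<^sub>0 \<ge> 0" "M \<ge> 10 * \<nu> * lam\<^sup>2" "a t\<^sub>0 k \<ge> M"
  shows "\<exists>t\<ge>0. a t 1 \<ge> M"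
  using assms
proof (induction k arbitrary: t\<^sub>0 rule: less_induct)
  case (less k)
  have "\<nu> * lam\<^sup>2 > 0" using nu_pos lam_gt by simp
  then have M0: "M > 0" using less.prems by linarith
  show ?case
  proof (cases "k = 1")
    case False
    then have k: "2 \<le> k" "k \<le> n" using less.prems by auto
    obtain t where t: "t \<ge> 0" "a t (k - 1) \<ge> M \<or> a t (k - 2) \<ge> M"
      using truncated_transfer[OF k] less.prems by blast
    show ?thesis
    proof (cases "a t (k - 1) \<ge> M")
      case True
      moreover have "k - 1 < k" "k - 1 \<in> {1..n}" using k by auto
      ultimately show ?thesis using less.IH t less.prems by blast
    next
      case False
      then have "a t (k - 2) \<ge> M" using t by simp
      moreover from this have "k - 2 \<noteq> 0" using truncated_0[OF t(1)] M0 by auto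
      moreover from this have "k - 2 < k" "k - 2 \<in> {1..n}" using k by auto
      ultimately show ?thesis using less.IH t less.prems by blast
    qed
  qed (use less.prems in auto)
qed

text \<open>For \<open>\<delta> \<le> \<nu> / \<mu>\<close> the feed is dominated by damping at the
  barrier: \<open>\<mu> \<delta>^2 \<le> \<nu> \<delta>\<close>. Read contrapositively, a mode can
  become large only if the mode above it does.\<close>

lemma truncated_small_step:
  assumes k: "k \<in> {1..n}" and T: "T \<ge> 0" "t \<ge> T" and \<delta>: "0 \<le> \<delta>" "\<delta> \<le> \<nu> / \<mu>"
    and "a T k \<le> \<delta>" "\<And>t. t \<ge> T \<Longrightarrow> a t (k + 1) \<le> \<delta>"
  shows "a t k \<le> \<delta>"
proof (rule barrier_upper[where c = "w k * \<nu>", OF truncated_deriv[OF k T(1)] _ _ T(2)])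
  fix t assume t: "t \<ge> T"
  have "rhs (a t) k \<le> w k * (- \<nu> * a t k + \<mu> * \<delta>\<^sup>2)"
    using assms t by (intro rhs_upper) auto
  moreover have "\<mu> * \<delta> \<le> \<nu>" using \<delta> mu_gt by (simp add: field_simps)
  then have "\<mu> * \<delta>\<^sup>2 \<le> \<nu> * \<delta>" using \<delta> by (simp add: power2_eq_square mult_right_mono flip: mult.assoc)
  then have "w k * (- \<nu> * a t k + \<mu> * \<delta>\<^sup>2) \<le> w k * (- \<nu> * a t k + \<nu> * \<delta>)"
    using w_pos[of k] by simp
  ultimately show "rhs (a t) k \<le> - (w k * \<nu>) * (a t k - \<delta>)" by (simp add: algebra_simps)
qed (use assms in auto)

lemma truncated_small:
  assumes T: "T \<ge> 0" and \<delta>: "0 \<le> \<delta>" "\<delta> \<le> \<nu> / \<mu>" and init: "\<And>k. a T k \<le> \<delta>" and t: "t \<ge> T"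
  shows "a t k \<le> \<delta>"
proof (cases "1 \<le> k \<and> k \<le> n")
  case True
  then have "k \<le> n" "1 \<le> k" by auto
  then show ?thesis using t
  proof (induction k arbitrary: t rule: inc_induct)
    case base
    show ?case
    proof (rule truncated_small_step[OF _ T base(2) \<delta> init])
      show "a t (n + 1) \<le> \<delta>" if "t \<ge> T" for t using that T \<delta> by (simp add: truncated_beyond)
    qed (use base in simp)
  next
    case (step k)
    show ?case
    proof (rule truncated_small_step[OF _ T step.prems(2) \<delta> init])
      show "a t (k + 1) \<le> \<delta>" if "t \<ge> T" for t using step.IH[OF _ that] by simp
    qed (use step in simp)
  qed
next
  case False
  then show ?thesis using truncated_0[of t] truncated_beyond[of t k] T t \<delta> by (cases "k = 0") auto
qed

text \<open>The bound \<open>M\<close> and the decay of mode \<open>k + 1\<close> at rate \<open>\<nu> w\<^sub>k\<^sub>+\<^sub>1 \<ge> 4 \<nu> w\<^sub>k\<close> combine to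
  \<open>a\<^sub>k\<^sub>+\<^sub>1 \<le> M p exp (- 2 \<nu> w\<^sub>k t)\<close> with \<open>p = 1 + \<mu> M / \<nu>\<close>.  This costs only one of the two factors \<open>p\<close>
  in the constant \<open>M p\<^sup>2\<close>, so the induction closes with the same constant for all \<open>k\<close>.\<close>

lemma truncated_decay:
  assumes M: "\<And>t k. t \<ge> 0 \<Longrightarrow> a t k \<le> M" and t: "t \<ge> 0"
  shows "a t k \<le> M * (1 + \<mu> * M / \<nu>)\<^sup>2 * exp (- \<nu> * w k * t)"
proof -
  define p where "p = 1 + \<mu> * M / \<nu>"
  have M0: "M \<ge> 0" using M[of 0 0] truncated_0[of 0] by simp
  have p: "p \<ge> 1" "\<mu> * M / \<nu> \<le> p" using M0 nu_pos mu_gt by (simp_all add: p_def)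
  have Mp: "M \<le> M * p\<^sup>2" using M0 p by (simp add: mult_le_cancel_left1)
  have "a t k \<le> M * p\<^sup>2 * exp (- \<nu> * w k * t)"
  proof (cases "1 \<le> k \<and> k \<le> n")
    case True
    then have "k \<le> n" "1 \<le> k" by auto
    then show ?thesis using t
    proof (induction k arbitrary: t rule: inc_induct)
      case base
      have "a t n - 0 \<le> (a 0 n - 0) * exp (- (\<nu> * w n) * (t - 0))"
      proof (rule exp_comparison[OF truncated_deriv[of n 0] _ \<open>t \<ge> 0\<close>])
        fix t :: real assume "t \<ge> 0"
        then show "rhs (a t) n \<le> - (\<nu> * w n) * (a t n - 0)"
          using rhs_upper[of t n 0] by (simp add: truncated_beyond algebra_simps)
      qed (use base in auto)
      also have "\<dots> \<le> (M * p\<^sup>2) * exp (- (\<nu> * w n) * (t - 0))"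
        using M[of 0 n] Mp by (intro mult_right_mono) auto
      finally show ?case by simp
    next
      case (step k)
      define c where "c = \<nu> * w k"
      have c0: "c > 0" using nu_pos w_pos by (simp add: c_def)
      have kn: "k \<in> {1..n}" using step by auto
      \<comment> \<open>The second summand compensates the feed: \<open>a t k * exp (c * t)\<close>
        grows at rate at most \<open>w k * \<mu> * (M * M * p) * exp (- c * t)\<close>.\<close>
      define h where "h t = a t k * exp (c * t) + \<mu> / \<nu> * (M * M * p) * exp (- c * t)" for t
      have "h t \<le> h 0"
      proof (rule nonincreasing_on_halfline[OF _ _ \<open>t \<ge> 0\<close>])
        fix t :: real assume t: "t \<ge> 0"
        show "(h has_real_derivative (rhs (a t) k + c * a t k) * exp (c * t) - w k * \<mu> * (M * M * p) * exp (- c * t)) (at t within {0..})"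
          unfolding h_def using nu_pos
          by (auto intro!: derivative_eq_intros truncated_deriv[OF kn _ t] simp: algebra_simps c_def)
        have "c * 4 \<le> \<nu> * w (Suc k)"
          using nu_pos w_pos[of k] lam2_gt by (simp add: c_def w_Suc mult.assoc mult.commute[of _ "lam\<^sup>2"])
        then have "c * 4 * t \<le> \<nu> * w (Suc k) * t" using t by (rule mult_right_mono)
        then have "exp (- \<nu> * w (Suc k) * t) \<le> exp (- (c * 4 * t))" by simp
        then have "M * p\<^sup>2 * exp (- \<nu> * w (Suc k) * t) \<le> M * p\<^sup>2 * exp (- (c * 4 * t))"
          using M0 by (intro mult_left_mono) auto
        then have "a t (Suc k) \<le> M * p\<^sup>2 * exp (- (c * 4 * t))"
          using step.IH[of t] step.hyps step.prems t by simp
        \<comment> \<open>Geometric mean of the bounds \<open>M\<close> and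
          \<open>M p^2 exp (- 4 c t)\<close>. The remaining rate \<open>2 c\<close> still beats the
          integrating factor \<open>exp (c t)\<close>.\<close>
        then have "a t (Suc k) * a t (Suc k) \<le> M * (M * p\<^sup>2 * exp (- (c * 4 * t)))"
          using M[OF t] truncated_nonneg[OF t] M0 by (intro mult_mono) auto
        also have "\<dots> = (M * p * exp (- (c * 2 * t)))\<^sup>2"
          by (simp add: power2_eq_square mult_ac flip: exp_add)
        finally have "(a t (Suc k))\<^sup>2 \<le> (M * p * exp (- (c * 2 * t)))\<^sup>2" by (simp add: power2_eq_square)
        moreover have "M * p * exp (- (c * 2 * t)) \<ge> 0" using M0 p by simp
        ultimately have "a t (Suc k) \<le> M * p * exp (- (c * 2 * t))" by (rule power2_le_imp_le)
        then have sq: "a t (Suc k) * a t (Suc k) \<le> M * (M * p * exp (- (c * 2 * t)))"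
          using M[OF t] truncated_nonneg[OF t] M0 by (intro mult_mono) auto
        have "rhs (a t) k + c * a t k \<le> w k * \<mu> * (a t (Suc k) * a t (Suc k))"
          using rhs_upper[OF t, of k "a t (k + 1)"] by (simp add: c_def algebra_simps power2_eq_square)
        also have "\<dots> \<le> w k * \<mu> * (M * (M * p * exp (- (c * 2 * t))))"
          using sq w_pos[of k] mu_gt by (intro mult_left_mono) auto
        finally have "(rhs (a t) k + c * a t k) * exp (c * t) \<le> w k * \<mu> * (M * (M * p * exp (- (c * 2 * t)))) * exp (c * t)"
          by (intro mult_right_mono) auto
        also have "\<dots> = w k * \<mu> * (M * M * p) * exp (- c * t)"
          by (simp add: mult.assoc flip: exp_add)
        finally show "(rhs (a t) k + c * a t k) * exp (c * t) - w k * \<mu> * (M * M * p) * exp (- c * t) \<le> 0" by simp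
      qed
      moreover have "a 0 k = 0" using truncated_initial step.hyps by simp
      then have "h 0 = \<mu> * M / \<nu> * (M * p)" by (simp add: h_def)
      moreover have "\<mu> * M / \<nu> * (M * p) \<le> p * (M * p)" using p M0 by (intro mult_right_mono) auto
      moreover have "\<mu> / \<nu> * (M * M * p) * exp (- c * t) \<ge> 0" using nu_pos mu_gt M0 p by simp
      ultimately have "a t k * exp (c * t) \<le> M * p\<^sup>2"
        by (simp add: h_def power2_eq_square mult_ac)
      then have "a t k * exp (c * t) * exp (- c * t) \<le> M * p\<^sup>2 * exp (- c * t)"
        by (rule mult_right_mono) simp
      then show ?case by (simp add: c_def mult.assoc flip: exp_add)
    qed
  next
    case False
    then show ?thesis using truncated_0[of t] truncated_beyond[of t k] t M0 by (cases "k = 0") auto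
  qed
  then show ?thesis by (simp add: p_def)
qed

end

section \<open>Tuning the initial amplitude\<close>

definition level :: real where "level = 10 * \<nu> * lam\<^sup>2"

text \<open>Half of the balance value \<open>\<nu> / \<mu>\<close>: the other half is room for
  perturbing the amplitude.\<close>

definition threshold :: real where "threshold = \<nu> / (2 * \<mu>)"

lemma level_pos: "level > 0" using nu_pos lam_gt by (simp add: level_def)

lemma threshold_pos: "threshold > 0" using nu_pos mu_gt by (simp add: threshold_def)

lemma threshold_le_level: "2 * threshold \<le> level"
proof -
  have "\<nu> / \<mu> \<le> \<nu> / 1" using nu_pos mu_gt by (intro divide_left_mono) auto
  also have "\<dots> \<le> \<nu> * (10 * lam\<^sup>2)" using nu_pos lam2_gt by simp
  finally show ?thesis by (simp add: threshold_def level_def)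
qed

lemma truncated_le_level:
  assumes sol: "truncated_solution n A a" and a1: "\<And>t. t \<ge> 0 \<Longrightarrow> a t 1 \<le> level" and t: "t \<ge> 0"
  shows "a t k \<le> level"
proof (rule ccontr)
  assume c: "\<not> a t k \<le> level"
  have "k \<in> {1..n}"
  proof (rule ccontr)
    assume "k \<notin> {1..n}"
    then have "k = 0 \<or> k > n" by auto
    then show False using c truncated_0[OF sol t] truncated_beyond[OF sol t] level_pos by auto
  qed
  then obtain s where "s \<ge> 0" "a s 1 \<ge> a t k"
    using truncated_reaches_first[OF sol _ t, of k "a t k"] c by (auto simp: level_def)
  then show False using a1[of s] c by simp
qed

text \<open>The amplitude \<open>A\<close> of the initial mode is tuned to the largest value for which mode 1 never
  exceeds \<open>level\<close>.  If mode 1 stayed below \<open>threshold\<close>, it would stay below \<open>level\<close> also for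
  slightly larger \<open>A\<close>: on bounded times by continuity, later by decay.\<close>

lemma tuned_truncated_solution:
  assumes n: "n \<ge> 1"
  shows "\<exists>a A. truncated_solution n A a \<and> (\<forall>t\<ge>0. \<forall>k. a t k \<le> level) \<and>
    (\<forall>k\<in>{1..n}. \<exists>t\<ge>0. a t k > threshold)"
proof -
  have "level + 1 \<ge> 0" using level_pos by simp
  from truncated_solutions_exist[OF n this]
  obtain a L where ex: "\<forall>A\<in>{0..level + 1}. truncated_solution n A (a A)"
    "\<forall>A B. \<forall>t\<ge>0. \<forall>k. \<bar>a A t k - a B t k\<bar> \<le> 2 * exp (2 * L * t) * \<bar>A - B\<bar>"
    by (elim exE conjE)
  have sol: "truncated_solution n A (a A)" if "A \<in> {0..level + 1}" for A
    using ex(1) that by (rule bspec)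
  have lip: "\<bar>a A t k - a B t k\<bar> \<le> 2 * exp (2 * L * t) * \<bar>A - B\<bar>" if "t \<ge> 0" for A B t k
    using ex(2) that by simp
  \<comment> \<open>The non-strict bound makes \<open>P\<close> closed, so the largest admissible
    amplitude is attained and is itself admissible.\<close>
  define P where "P = {0..level + 1} \<inter> (\<Inter>t\<in>{0..}. (\<lambda>A. a A t 1) -` {..level})"
  have "closed ((\<lambda>A. a A t 1) -` {..level})" if "t \<ge> 0" for t
  proof -
    have "(2 * exp (2 * L * t))-lipschitz_on UNIV (\<lambda>A. a A t 1)"
      using lip[OF that] by (auto simp: lipschitz_on_def dist_real_def)
    then have "continuous_on UNIV (\<lambda>A. a A t 1)" by (rule lipschitz_on_continuous_on)
    then show ?thesis by (intro closed_vimage) auto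
  qed
  then have "compact P" unfolding P_def by (intro compact_Int_closed closed_INT) auto
  moreover have "0 \<in> P"
  proof -
    have s0: "truncated_solution n 0 (a 0)" using sol level_pos by simp
    have "a 0 t 1 \<le> 0" if "t \<ge> 0" for t
      using truncated_small[OF s0, of 0 0 t 1] truncated_initial[OF s0] that nu_pos mu_gt by simp
    then show ?thesis using level_pos by (force simp: P_def)
  qed
  ultimately obtain A where A: "A \<in> P" "\<And>B. B \<in> P \<Longrightarrow> B \<le> A"
    using compact_attains_sup[of P] by auto
  have AI: "A \<in> {0..level + 1}" and A1: "\<And>t. t \<ge> 0 \<Longrightarrow> a A t 1 \<le> level"
    using A(1) by (auto simp: P_def)
  note solA = sol[OF AI]
  have le: "a A t k \<le> level" if "t \<ge> 0" for t k
    by (rule truncated_le_level[OF solA A1 that])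
  \<comment> \<open>Mode \<open>n\<close> starts at \<open>A\<close>, so the maximum is not at the
    end \<open>level + 1\<close> of the interval and \<open>A\<close> can still be
    increased.\<close>
  have "a A 0 n \<le> level" using le by simp
  then have A_lt: "A < level + 1" using truncated_initial[OF solA, of n] by simp
  have first: "\<exists>t\<ge>0. a A t 1 > threshold"
  proof (rule ccontr)
    assume "\<not> ?thesis"
    then have small: "a A t 1 \<le> threshold" if "t \<ge> 0" for t using that by force
    define K where "K = level * (1 + \<mu> * level / \<nu>)\<^sup>2"
    \<comment> \<open>By \<open>exp x \<ge> x\<close> the decay bound has fallen below
      \<open>threshold\<close> at this time, for all modes at once since
      \<open>w k \<ge> 1\<close>.\<close>
    define T where "T = K / threshold / \<nu>"
    have K: "K \<ge> 0" using level_pos by (simp add: K_def)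
    then have T: "T \<ge> 0" using threshold_pos nu_pos by (simp add: T_def)
    have late: "a A T k \<le> threshold" for k
    proof -
      have "w k \<ge> 1" using w_mono[of 0 k] by (simp add: w_def)
      then have "\<nu> * T * 1 \<le> \<nu> * T * w k" using nu_pos T by (intro mult_left_mono) auto
      then have "exp (- \<nu> * w k * T) \<le> exp (- (\<nu> * T))" by (simp add: mult_ac)
      moreover have "a A T k \<le> K * exp (- \<nu> * w k * T)"
        unfolding K_def by (rule truncated_decay[OF solA le T])
      ultimately have "a A T k \<le> K * exp (- (\<nu> * T))" using K by (meson mult_left_mono order_trans)
      moreover have "K / threshold \<le> exp (\<nu> * T)"
      proof -
        have "\<nu> * T = K / threshold" using nu_pos by (simp add: T_def)
        then show ?thesis using exp_ge_add_one_self[of "\<nu> * T"] by linarith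
      qed
      then have "K * exp (- (\<nu> * T)) \<le> threshold"
        using threshold_pos by (simp add: exp_minus field_simps)
      ultimately show ?thesis by linarith
    qed
    \<comment> \<open>Up to time \<open>T\<close> this change of amplitude moves each mode by at
      most \<open>threshold\<close>. At \<open>T\<close> all modes are then below
      \<open>\<nu> / \<mu>\<close>, and \<open>truncated_small\<close> takes over for good.\<close>
    define \<epsilon> where "\<epsilon> = threshold / (2 * exp (2 * \<bar>L\<bar> * T))"
    define B where "B = min (level + 1) (A + \<epsilon>)"
    have eps: "\<epsilon> > 0" using threshold_pos by (simp add: \<epsilon>_def)
    have BI: "B \<in> {0..level + 1}" and AB: "A < B" "\<bar>B - A\<bar> \<le> \<epsilon>"
      using AI A_lt eps by (auto simp: B_def)
    note solB = sol[OF BI]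
    have close: "a B t k \<le> a A t k + threshold" if t: "0 \<le> t" "t \<le> T" for t k
    proof -
      have "L * t \<le> \<bar>L\<bar> * T" using t by (intro mult_mono) auto
      then have "exp (2 * L * t) \<le> exp (2 * \<bar>L\<bar> * T)" by simp
      then have "2 * exp (2 * L * t) * \<bar>B - A\<bar> \<le> 2 * exp (2 * \<bar>L\<bar> * T) * \<epsilon>"
        using AB by (intro mult_mono) auto
      also have "\<dots> = threshold" by (simp add: \<epsilon>_def)
      finally show ?thesis using lip[OF t(1), of B k A] by linarith
    qed
    have "a B t 1 \<le> 2 * threshold" if t: "t \<ge> 0" for t
    proof (cases "t \<le> T")
      case True
      then show ?thesis using close[OF t, of 1] small[OF t] by simp
    next
      case False
      show ?thesis
      proof (rule truncated_small[OF solB T])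
        show "a B T k \<le> 2 * threshold" for k using close[OF T order_refl, of k] late[of k] by simp
      qed (use False threshold_pos in \<open>auto simp: threshold_def\<close>)
    qed
    then have "B \<in> P" using BI threshold_le_level by (force simp: P_def)
    then show False using A(2) AB by force
  qed
  \<comment> \<open>Climbs from mode 1: a mode below the top starts from zero, so it passes
    \<open>threshold\<close> only if the next higher mode does.\<close>
  have "\<exists>t\<ge>0. a A t k > threshold" if "1 \<le> k" "k \<le> n" for k
    using that
  proof (induction k rule: dec_induct)
    case base
    show ?case by (rule first)
  next
    case (step k)
    show ?case
    proof (rule ccontr)
      assume "\<not> ?case"
      then have small: "a A t (k + 1) \<le> threshold" if "t \<ge> 0" for t using that by force
      have "threshold \<le> \<nu> / \<mu>" using nu_pos mu_gt by (simp add: threshold_def field_simps)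
      moreover have "a A 0 k \<le> threshold"
        using truncated_initial[OF solA, of k] step threshold_pos by simp
      moreover have "k \<in> {1..n}" using step by simp
      ultimately have "a A t k \<le> threshold" if "t \<ge> 0" for t
        using truncated_small_step[OF solA, of k 0 t threshold] that small threshold_pos by simp
      then show False using step by (force simp: not_le[symmetric])
    qed
  qed
  then show ?thesis using solA le by (intro exI[of _ "a A"] exI[of _ A]) simp
qed

text \<open>The second-order bound on the increments is preserved by pointwise limits, unlike the
  differential equation itself.\<close>

lemma truncated_taylor:
  assumes sol: "truncated_solution n A a" and le: "\<And>t k. t \<ge> 0 \<Longrightarrow> a t k \<le> M"
  defines "C \<equiv> \<nu> * M + \<mu> * M\<^sup>2 + M\<^sup>2"
  shows truncated_lipschitz: "s \<ge> 0 \<Longrightarrow> t \<ge> 0 \<Longrightarrow> \<bar>a t k - a s k\<bar> \<le> w k * C * \<bar>t - s\<bar>"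
    and "k \<in> {1..n} \<Longrightarrow> s \<ge> 0 \<Longrightarrow> t \<ge> 0 \<Longrightarrow> \<bar>a t k - a s k - rhs (a s) k * (t - s)\<bar>
      \<le> w k * (\<nu> + 2 * \<mu> * M + 2 * M) * (w (k + 1) * C) * (t - s)\<^sup>2"
proof -
  have nn: "a t k \<ge> 0" if "t \<ge> 0" for t k by (rule truncated_nonneg[OF sol that])
  have M0: "M \<ge> 0" using le[of 0 0] nn[of 0 0] by simp
  have C0: "C \<ge> 0" unfolding C_def using M0 nu_pos mu_gt by simp
  have mvt: "\<exists>z\<ge>0. \<bar>z - s\<bar> \<le> \<bar>t - s\<bar> \<and> a t k - a s k = rhs (a z) k * (t - s)"
    if k: "k \<in> {1..n}" and st: "s \<ge> 0" "t \<ge> 0" for s t k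
  proof -
    have *: "\<exists>z\<in>{s<..<t}. a t k - a s k = rhs (a z) k * (t - s)" if "s < t" "s \<ge> 0" for s t
    proof (rule mvt_simple[OF \<open>s < t\<close>])
      fix x assume "s \<le> x" "x \<le> t"
      then have "((\<lambda>t. a t k) has_real_derivative rhs (a x) k) (at x within {s..})"
        using truncated_deriv[OF sol k \<open>s \<ge> 0\<close>] by simp
      then show "((\<lambda>t. a t k) has_derivative (*) (rhs (a x) k)) (at x within {s..t})"
        unfolding has_field_derivative_def by (rule has_derivative_subset) auto
    qed
    consider "s < t" | "s = t" | "t < s" by linarith
    then show ?thesis
    proof cases
      case 1
      then obtain z where "z \<in> {s<..<t}" "a t k - a s k = rhs (a z) k * (t - s)" using * st by blast
      then show ?thesis using st by (intro exI[of _ z]) auto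
    next
      case 2
      then show ?thesis using st by (intro exI[of _ s]) auto
    next
      case 3
      then obtain z where "z \<in> {t<..<s}" "a s k - a t k = rhs (a z) k * (s - t)" using * st by blast
      then show ?thesis using st by (intro exI[of _ z]) (auto simp: algebra_simps)
    qed
  qed
  have rhs_bd: "\<bar>rhs (a t) k\<bar> \<le> w k * C" if t: "t \<ge> 0" for t k
  proof -
    have "(a t (k + 1))\<^sup>2 \<le> M\<^sup>2" using nn[OF t] le[OF t] by (intro power_mono)
    then have "\<mu> * (a t (k + 1))\<^sup>2 \<le> \<mu> * M\<^sup>2" "\<mu> * (a t (k + 1))\<^sup>2 \<ge> 0" using mu_gt by auto
    moreover have "a t (k - 1) * a t k / lam\<^sup>2 \<le> M * M / 1"
      using nn[OF t] le[OF t] M0 lam2_gt by (intro frac_le mult_mono) auto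
    moreover have "a t (k - 1) * a t k / lam\<^sup>2 \<ge> 0" using nn[OF t] by simp
    moreover have "\<nu> * a t k \<le> \<nu> * M" "\<nu> * a t k \<ge> 0" "\<nu> * M \<ge> 0"
      using nn[OF t] le[OF t] nu_pos M0 by auto
    ultimately have "\<bar>- \<nu> * a t k + \<mu> * (a t (k + 1))\<^sup>2 - a t (k - 1) * a t k / lam\<^sup>2\<bar> \<le> C"
      unfolding C_def by (simp add: power2_eq_square abs_le_iff)
    then have "w k * \<bar>- \<nu> * a t k + \<mu> * (a t (k + 1))\<^sup>2 - a t (k - 1) * a t k / lam\<^sup>2\<bar> \<le> w k * C"
      using w_pos[of k] by (intro mult_left_mono) auto
    then show ?thesis using w_pos[of k] by (simp add: rhs_def abs_mult)
  qed
  have lip: "\<bar>a t k - a s k\<bar> \<le> w k * C * \<bar>t - s\<bar>" if st: "s \<ge> 0" "t \<ge> 0" for s t k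
  proof (cases "k \<in> {1..n}")
    case True
    obtain z where z: "z \<ge> 0" "a t k - a s k = rhs (a z) k * (t - s)" using mvt[OF True st] by blast
    then show ?thesis using mult_right_mono[OF rhs_bd[OF z(1), of k], of "\<bar>t - s\<bar>"] by (simp add: abs_mult)
  next
    case False
    then have "k = 0 \<or> k > n" by auto
    then have "a t k = 0" "a s k = 0" using truncated_0[OF sol] truncated_beyond[OF sol] st by auto
    then show ?thesis using C0 w_pos[of k] by simp
  qed
  show "s \<ge> 0 \<Longrightarrow> t \<ge> 0 \<Longrightarrow> \<bar>a t k - a s k\<bar> \<le> w k * C * \<bar>t - s\<bar>" by (rule lip)
  assume k: "k \<in> {1..n}" and st: "s \<ge> 0" "t \<ge> 0"
  obtain z where z: "z \<ge> 0" "\<bar>z - s\<bar> \<le> \<bar>t - s\<bar>" "a t k - a s k = rhs (a z) k * (t - s)"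
    using mvt[OF k st] by blast
  have "\<bar>rhs (a z) k - rhs (a s) k\<bar> \<le> w k * (\<nu> + 2 * \<mu> * M + 2 * M) * (w (k + 1) * C * \<bar>t - s\<bar>)"
  proof (rule rhs_lipschitz)
    show "\<bar>a z j\<bar> \<le> M" "\<bar>a s j\<bar> \<le> M" for j using nn le z st by auto
    fix j assume "j \<le> k + 1"
    then have "w j * C * \<bar>z - s\<bar> \<le> w (k + 1) * C * \<bar>t - s\<bar>"
      using z C0 w_pos[of "k+1"] by (intro mult_mono w_mono) auto
    then show "\<bar>a z j - a s j\<bar> \<le> w (k + 1) * C * \<bar>t - s\<bar>"
      using lip[OF st(1) z(1), of j] by linarith
  qed
  then have "\<bar>rhs (a z) k - rhs (a s) k\<bar> * \<bar>t - s\<bar>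
      \<le> w k * (\<nu> + 2 * \<mu> * M + 2 * M) * (w (k + 1) * C * \<bar>t - s\<bar>) * \<bar>t - s\<bar>"
    by (intro mult_right_mono) auto
  moreover have "a t k - a s k - rhs (a s) k * (t - s) = (rhs (a z) k - rhs (a s) k) * (t - s)"
    by (simp add: z left_diff_distrib)
  ultimately show "\<bar>a t k - a s k - rhs (a s) k * (t - s)\<bar>
      \<le> w k * (\<nu> + 2 * \<mu> * M + 2 * M) * (w (k + 1) * C) * (t - s)\<^sup>2"
    by (simp add: abs_mult power2_eq_square mult.assoc)
qed

section \<open>Passage to the limit\<close>

text \<open>The window is what keeps the limit nontrivial and yields the blow-up rate. Both of its
  edges scale like \<open>1 / w k\<close> with constants independent of \<open>n\<close>, so hitting
  times of the truncations accumulate inside it.\<close>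

lemma scaled_solution_exists:
  "\<exists>b K c C. c > 0 \<and> C > 0 \<and>
     (\<forall>t\<ge>0. b t 0 = 0) \<and> (\<forall>k. b 0 k = 0) \<and>
     (\<forall>t\<ge>0. \<forall>k. 0 \<le> b t k \<and> b t k \<le> K * exp (- \<nu> * w k * t)) \<and>
     (\<forall>k\<ge>1. \<forall>t\<ge>0. ((\<lambda>t. b t k) has_real_derivative rhs (b t) k) (at t within {0..})) \<and>
     (\<forall>k\<ge>1. \<exists>t. c / w k \<le> t \<and> t \<le> C / w k \<and> b t k \<ge> threshold)"
proof -
  have "\<forall>n. \<exists>a. \<exists>A. truncated_solution (Suc n) A a \<and> (\<forall>t\<ge>0. \<forall>k. a t k \<le> level) \<and>
     (\<forall>k\<in>{1..Suc n}. \<exists>t\<ge>0. a t k > threshold)"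
    using tuned_truncated_solution by simp
  from choice[OF this] obtain a where
    a: "\<forall>n. \<exists>A. truncated_solution (Suc n) A (a n) \<and> (\<forall>t\<ge>0. \<forall>k. a n t k \<le> level) \<and>
     (\<forall>k\<in>{1..Suc n}. \<exists>t\<ge>0. a n t k > threshold)" ..
  from choice[OF this] obtain A where
    A: "\<forall>n. truncated_solution (Suc n) (A n) (a n) \<and> (\<forall>t\<ge>0. \<forall>k. a n t k \<le> level) \<and>
     (\<forall>k\<in>{1..Suc n}. \<exists>t\<ge>0. a n t k > threshold)" ..
  then have sol: "truncated_solution (Suc n) (A n) (a n)" for n by simp
  have le: "a n t k \<le> level" if "t \<ge> 0" for n t k using A that by simp
  have nn: "a n t k \<ge> 0" if "t \<ge> 0" for n t k using truncated_nonneg[OF sol that] .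
  \<comment> \<open>Truncation \<open>n\<close> uses \<open>Suc n\<close> modes: at least one mode
    exists, and all modes up to \<open>n\<close> start from zero.\<close>
  have init: "a n 0 k = 0" if "k \<le> n" for n k using truncated_initial[OF sol, of n k] that by simp
  define K where "K = level * (1 + \<mu> * level / \<nu>)\<^sup>2"
  have decay: "a n t k \<le> K * exp (- \<nu> * w k * t)" if "t \<ge> 0" for n t k
    unfolding K_def by (rule truncated_decay[OF sol le that])
  have "\<mu> * level / \<nu> > 0" using level_pos nu_pos mu_gt by simp
  then have "1 + \<mu> * level / \<nu> > 0" by linarith
  then have K: "K > 0" using level_pos by (simp add: K_def)
  define L where "L = \<nu> * level + \<mu> * level\<^sup>2 + level\<^sup>2"
  have L: "L > 0" unfolding L_def using level_pos nu_pos mu_gt by (intro add_pos_pos mult_pos_pos) auto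
  define E where "E k = w k * (\<nu> + 2 * \<mu> * level + 2 * level) * (w (k + 1) * L)" for k
  have lip: "\<bar>a n t k - a n s k\<bar> \<le> w k * L * \<bar>t - s\<bar>" if "s \<ge> 0" "t \<ge> 0" for n s t k
    unfolding L_def by (rule truncated_lipschitz[OF sol le that])
  have taylor: "\<bar>a n t k - a n s k - rhs (a n s) k * (t - s)\<bar> \<le> E k * (t - s)\<^sup>2"
    if "1 \<le> k" "k \<le> n" "s \<ge> 0" "t \<ge> 0" for n s t k
    unfolding E_def L_def using that by (intro truncated_taylor(2)[OF sol le]) auto
  define c where "c = threshold / L"
  define C where "C = K / (threshold * \<nu>)"
  have c: "c > 0" and C: "C > 0" using threshold_pos L K nu_pos by (simp_all add: c_def C_def)
  have window: "\<exists>t. c / w k \<le> t \<and> t \<le> C / w k \<and> a n t k \<ge> threshold" if k: "1 \<le> k" "k \<le> n" for n k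
  proof -
    obtain t where t: "t \<ge> 0" "a n t k > threshold" using A k by fastforce
    \<comment> \<open>Lower edge: the mode starts at zero and moves at speed at most
      \<open>w k * L\<close>. Upper edge, below: the decay bound cannot lie under
      \<open>threshold\<close> yet.\<close>
    have "threshold \<le> w k * L * t" using lip[of 0 t n k] init[OF k(2)] t by simp
    then have "c / w k \<le> t" using w_pos[of k] L by (simp add: c_def field_simps)
    moreover have "t \<le> C / w k"
    proof -
      have "threshold * exp (\<nu> * w k * t) \<le> K * exp (- \<nu> * w k * t) * exp (\<nu> * w k * t)"
        using t decay[OF t(1), of n k] by (intro mult_right_mono) auto
      then have "threshold * exp (\<nu> * w k * t) \<le> K" by (simp add: mult.assoc flip: exp_add)
      moreover have "threshold * (\<nu> * w k * t) \<le> threshold * exp (\<nu> * w k * t)"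
        using exp_ge_add_one_self[of "\<nu> * w k * t"] threshold_pos by (intro mult_left_mono) linarith+
      ultimately have "threshold * (\<nu> * w k * t) \<le> K" by linarith
      then show ?thesis using threshold_pos nu_pos w_pos[of k] by (simp add: C_def field_simps)
    qed
    ultimately show ?thesis using t by force
  qed
  define \<tau> where "\<tau> n k = (if 1 \<le> k \<and> k \<le> n
     then SOME t. c / w k \<le> t \<and> t \<le> C / w k \<and> a n t k \<ge> threshold else 0)" for n k
  have \<tau>: "c / w k \<le> \<tau> n k \<and> \<tau> n k \<le> C / w k \<and> a n (\<tau> n k) k \<ge> threshold" if "1 \<le> k" "k \<le> n" for n k
    using someI_ex[OF window[OF that]] that by (simp add: \<tau>_def)
  have w_pos': "c / w k > 0" for k using c w_pos by simp
  have \<tau>0: "0 \<le> \<tau> n k \<and> \<tau> n k \<le> C" for n k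
  proof (cases "1 \<le> k \<and> k \<le> n")
    case True
    have "C / w k \<le> C / 1" using C w_mono[of 0 k] by (intro divide_left_mono) (auto simp: w_def)
    then show ?thesis using \<tau>[of k n] True w_pos'[of k] by auto
  next
    case False
    then show ?thesis using C by (auto simp: \<tau>_def)
  qed
  \<comment> \<open>Hitting times enter as functions constant in time, so one extraction makes modes
    and times converge together. Outside \<open>1 \<le> k \<le> n\<close> the default
    \<open>0\<close> of \<open>\<tau>\<close> keeps them bounded.\<close>
  define f :: "nat \<Rightarrow> nat + nat \<Rightarrow> real \<Rightarrow> real"
    where "f n i t = (case i of Inl k \<Rightarrow> a n t k | Inr k \<Rightarrow> \<tau> n k)" for n i t
  obtain r :: "nat \<Rightarrow> nat" and g where r: "strict_mono r"
    and g: "\<And>i t. t \<ge> 0 \<Longrightarrow> (\<lambda>n. f (r n) i t) \<longlonglongrightarrow> g i t"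
  proof (rule equi_lipschitz_subsequence[of f "level + C" "\<lambda>i. case i of Inl k \<Rightarrow> w k * L | Inr k \<Rightarrow> 0"])
    show "\<bar>f n i t\<bar> \<le> level + C" if "t \<ge> 0" for n i t
      using le[OF that] nn[OF that] \<tau>0 C level_pos
      by (auto simp: f_def split: sum.split intro: order_trans add_increasing add_increasing2)
    show "\<bar>f n i t - f n i s\<bar> \<le> (case i of Inl k \<Rightarrow> w k * L | Inr k \<Rightarrow> 0) * \<bar>t - s\<bar>"
      if "s \<ge> 0" "t \<ge> 0" for n i s t
      using lip[OF that] by (simp add: f_def split: sum.split)
  qed blast
  define b where "b t k = g (Inl k) t" for t k
  define \<tau>' where "\<tau>' k = g (Inr k) 0" for k
  have b: "(\<lambda>n. a (r n) t k) \<longlonglongrightarrow> b t k" if "t \<ge> 0" for t k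
    using g[OF that, of "Inl k"] by (simp add: f_def b_def)
  have \<tau>': "(\<lambda>n. \<tau> (r n) k) \<longlonglongrightarrow> \<tau>' k" for k
    using g[of 0 "Inr k"] by (simp add: f_def \<tau>'_def)
  have rn: "k \<le> r n" if "k \<le> n" for k n using seq_suble[OF r, of n] that by simp
  have b00: "b t 0 = 0" if "t \<ge> 0" for t
    using b[OF that, of 0] truncated_0[OF sol that] by (simp add: LIMSEQ_const_iff)
  have b0: "b 0 k = 0" for k
  proof (rule LIMSEQ_unique[OF b[OF order_refl]])
    show "(\<lambda>n. a (r n) 0 k) \<longlonglongrightarrow> 0"
      by (rule tendsto_eventually, rule eventually_sequentiallyI[of k]) (simp add: init rn)
  qed
  have b_nn: "0 \<le> b t k" and b_decay: "b t k \<le> K * exp (- \<nu> * w k * t)" if "t \<ge> 0" for t k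
    by (rule LIMSEQ_le_const[OF b[OF that]], simp add: nn that)
       (rule LIMSEQ_le_const2[OF b[OF that]], use decay that in simp)
  have b': "((\<lambda>t. b t k) has_real_derivative rhs (b s) k) (at s within {0..})"
    if k: "k \<ge> 1" and s: "s \<ge> 0" for k s
  proof (rule has_real_derivative_quadratic_bound)
    fix t :: real assume "t \<in> {0..}"
    then have t: "t \<ge> 0" by simp
    have "(\<lambda>n. \<bar>a (r n) t k - a (r n) s k - rhs (a (r n) s) k * (t - s)\<bar>)
       \<longlonglongrightarrow> \<bar>b t k - b s k - rhs (b s) k * (t - s)\<bar>"
      unfolding rhs_def by (intro tendsto_intros b s t) (use lam_gt in auto)
    then show "\<bar>b t k - b s k - rhs (b s) k * (t - s)\<bar> \<le> E k * (t - s)\<^sup>2"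
      by (rule LIMSEQ_le_const2) (use taylor[OF k rn s t] in blast)
  qed
  have b_window: "\<exists>t. c / w k \<le> t \<and> t \<le> C / w k \<and> b t k \<ge> threshold" if k: "k \<ge> 1" for k
  proof (intro exI[of _ "\<tau>' k"] conjI)
    show low: "c / w k \<le> \<tau>' k" 
      by (rule LIMSEQ_le_const[OF \<tau>']) (use \<tau>[OF k rn] in blast)
    show "\<tau>' k \<le> C / w k" 
      by (rule LIMSEQ_le_const2[OF \<tau>']) (use \<tau>[OF k rn] in blast)
    have p: "\<tau>' k \<ge> 0" using low w_pos'[of k] by linarith
    \<comment> \<open>Convergence is known only at fixed times; the Lipschitz bound, uniform in
      \<open>n\<close>, compares the value at \<open>\<tau>' k\<close> with that at the moving
      hitting time.\<close>
    have "(\<lambda>n. threshold - w k * L * \<bar>\<tau> (r n) k - \<tau>' k\<bar>) \<longlonglongrightarrow> threshold - w k * L * \<bar>\<tau>' k - \<tau>' k\<bar>"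
      by (intro tendsto_intros \<tau>')
    then have "(\<lambda>n. threshold - w k * L * \<bar>\<tau> (r n) k - \<tau>' k\<bar>) \<longlonglongrightarrow> threshold" by simp
    then show "threshold \<le> b (\<tau>' k) k"
    proof (rule LIMSEQ_le[OF _ b[OF p]])
      have "threshold - w k * L * \<bar>\<tau> (r n) k - \<tau>' k\<bar> \<le> a (r n) (\<tau>' k) k" if "n \<ge> k" for n
        using \<tau>[OF k rn[OF that]] lip[OF p, of "\<tau> (r n) k" "r n" k] \<tau>0[of "r n" k] by linarith
      then show "\<exists>N. \<forall>n\<ge>N. threshold - w k * L * \<bar>\<tau> (r n) k - \<tau>' k\<bar> \<le> a (r n) (\<tau>' k) k" by blast
    qed
  qed
  show ?thesis
    using c C b00 b0 b_nn b_decay b' b_window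
    by (intro exI[of _ b] exI[of _ K] exI[of _ c] exI[of _ C]) simp
qed

end

subsection \<open>Sobolev norms\<close>

lemma Limsup_ge_frequently:
  fixes f :: "'a \<Rightarrow> 'b::complete_linorder"
  assumes "\<exists>\<^sub>F x in F. c \<le> f x"
  shows "c \<le> Limsup F f"
  unfolding Limsup_def
proof (rule INF_greatest)
  fix P assume "P \<in> {P. eventually P F}"
  then have "\<exists>\<^sub>F x in F. P x \<and> c \<le> f x"
    using assms by (auto intro: eventually_frequently_simps elim: frequently_rev_mp eventually_mono)
  then obtain x where "P x" "c \<le> f x" by (auto dest: frequently_ex)
  then show "c \<le> Sup (f ` Collect P)" by (intro SUP_upper2[of x]) auto
qed

lemma freq_powr:
  assumes "lam > 0"
  shows "freq lam k powr p = lam powr (p * real k)"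
proof -
  have "freq lam k = lam powr real k" using assms by (simp add: freq_def powr_realpow)
  then show ?thesis by (simp add: powr_powr mult.commute)
qed

lemma H_norm_ge_term:
  assumes "x \<in> H_space lam s"
  shows "freq lam (Suc j) powr s * \<bar>x (Suc j)\<bar> \<le> H_norm lam s x"
  unfolding H_norm_def
proof (rule real_le_rsqrt)
  have "(freq lam (Suc j) powr s)\<^sup>2 = freq lam (Suc j) powr (2 * s)"
    by (simp only: power2_eq_square mult_2 powr_add)
  then have "(freq lam (Suc j) powr s * \<bar>x (Suc j)\<bar>)\<^sup>2 = freq lam (Suc j) powr (2 * s) * (x (Suc j))\<^sup>2"
    by (simp add: power_mult_distrib)
  also have "\<dots> = (\<Sum>k\<in>{j}. freq lam (Suc k) powr (2 * s) * (x (Suc k))\<^sup>2)" by simp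
  also have "\<dots> \<le> (\<Sum>k. freq lam (Suc k) powr (2 * s) * (x (Suc k))\<^sup>2)"
    using assms by (intro sum_le_suminf) (auto simp: H_space_def)
  finally show "(freq lam (Suc j) powr s * \<bar>x (Suc j)\<bar>)\<^sup>2
      \<le> (\<Sum>k. freq lam (Suc k) powr (2 * s) * (x (Suc k))\<^sup>2)" .
qed

text \<open>Dominated convergence for series. The majorant may depend on \<open>t\<^sub>0\<close>,
  since on \<open>{0<..}\<close> the exponential one degenerates as \<open>t\<^sub>0\<close> tends
  to \<open>0\<close>.\<close>

lemma continuous_in_H_dominated:
  assumes cont: "\<And>k. continuous_on I (\<lambda>t. X t (Suc k))"
    and dom: "\<And>t\<^sub>0. t\<^sub>0 \<in> I \<Longrightarrow> \<exists>e>0. \<exists>M. summable (\<lambda>k. freq lam (Suc k) powr (2 * s) * (M k)\<^sup>2) \<and>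
      (\<forall>t\<in>I. \<bar>t - t\<^sub>0\<bar> < e \<longrightarrow> (\<forall>k. \<bar>X t (Suc k)\<bar> \<le> M k))"
  shows "continuous_in_H lam s I X"
  unfolding continuous_in_H_def
proof (intro conjI ballI)
  fix t\<^sub>0 assume t0: "t\<^sub>0 \<in> I"
  obtain e M where e: "e > 0" and M: "summable (\<lambda>k. freq lam (Suc k) powr (2 * s) * (M k)\<^sup>2)"
    and bd: "\<And>t k. t \<in> I \<Longrightarrow> \<bar>t - t\<^sub>0\<bar> < e \<Longrightarrow> \<bar>X t (Suc k)\<bar> \<le> M k"
    using dom[OF t0] by blast
  show "X t\<^sub>0 \<in> H_space lam s"
    unfolding H_space_def mem_Collect_eq
  proof (rule summable_comparison_test'[OF M])
    fix k
    have "(X t\<^sub>0 (Suc k))\<^sup>2 \<le> (M k)\<^sup>2" using bd[OF t0, of k] e by (intro power2_le_iff_abs_le[THEN iffD2]) auto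
    then show "norm (freq lam (Suc k) powr (2 * s) * (X t\<^sub>0 (Suc k))\<^sup>2) \<le> freq lam (Suc k) powr (2 * s) * (M k)\<^sup>2"
      by (simp add: mult_left_mono)
  qed
  let ?F = "at t\<^sub>0 within I"
  show "((\<lambda>t. H_norm lam s (\<lambda>k. X t k - X t\<^sub>0 k)) \<longlongrightarrow> 0) ?F"
  proof (cases "?F = bot")
    case False
    have lim: "((\<lambda>t. freq lam (Suc k) powr (2 * s) * (X t (Suc k) - X t\<^sub>0 (Suc k))\<^sup>2) \<longlongrightarrow> 0) ?F" for k
    proof -
      have "((\<lambda>t. X t (Suc k)) \<longlongrightarrow> X t\<^sub>0 (Suc k)) ?F" using cont[of k] t0 by (simp add: continuous_on_def)
      then have "((\<lambda>t. freq lam (Suc k) powr (2 * s) * (X t (Suc k) - X t\<^sub>0 (Suc k))\<^sup>2)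
         \<longlongrightarrow> freq lam (Suc k) powr (2 * s) * (X t\<^sub>0 (Suc k) - X t\<^sub>0 (Suc k))\<^sup>2) ?F"
        by (intro tendsto_intros)
      then show ?thesis by simp
    qed
    have "\<forall>\<^sub>F t in ?F. \<forall>k. norm (freq lam (Suc k) powr (2 * s) * (X t (Suc k) - X t\<^sub>0 (Suc k))\<^sup>2)
        \<le> 4 * (freq lam (Suc k) powr (2 * s) * (M k)\<^sup>2)"
      unfolding eventually_at
    proof (intro exI[of _ e] conjI ballI impI allI e)
      fix t k assume t: "t \<in> I" "t \<noteq> t\<^sub>0 \<and> dist t t\<^sub>0 < e"
      have "\<bar>X t (Suc k) - X t\<^sub>0 (Suc k)\<bar> \<le> 2 * M k"
        using bd[of t k] bd[of t\<^sub>0 k] t t0 e by (auto simp: dist_real_def)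
      then have "(X t (Suc k) - X t\<^sub>0 (Suc k))\<^sup>2 \<le> (2 * M k)\<^sup>2"
        by (intro power2_le_iff_abs_le[THEN iffD2]) auto
      then have "(X t (Suc k) - X t\<^sub>0 (Suc k))\<^sup>2 \<le> 4 * (M k)\<^sup>2" by (simp add: power_mult_distrib)
      then have "freq lam (Suc k) powr (2 * s) * (X t (Suc k) - X t\<^sub>0 (Suc k))\<^sup>2
          \<le> freq lam (Suc k) powr (2 * s) * (4 * (M k)\<^sup>2)"
        by (rule mult_left_mono) simp
      then show "norm (freq lam (Suc k) powr (2 * s) * (X t (Suc k) - X t\<^sub>0 (Suc k))\<^sup>2)
          \<le> 4 * (freq lam (Suc k) powr (2 * s) * (M k)\<^sup>2)" by (simp add: mult_ac)
    qed
    then have "\<forall>\<^sub>F (k, t) in at_top \<times>\<^sub>F ?F. norm (freq lam (Suc k) powr (2 * s) * (X t (Suc k) - X t\<^sub>0 (Suc k))\<^sup>2)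
        \<le> 4 * (freq lam (Suc k) powr (2 * s) * (M k)\<^sup>2)"
      unfolding eventually_prod_filter by (intro exI[of _ "\<lambda>_. True"] exI conjI) auto
    from tannerys_theorem[OF lim this summable_mult[OF M] False]
    have "((\<lambda>t. sqrt (\<Sum>k. freq lam (Suc k) powr (2 * s) * (X t (Suc k) - X t\<^sub>0 (Suc k))\<^sup>2)) \<longlongrightarrow> sqrt (\<Sum>k. 0)) ?F"
      by (intro tendsto_real_sqrt) simp
    then show ?thesis by (simp add: H_norm_def)
  qed simp
qed

text \<open>Ratio test: the gap \<open>lam ^ (2 * Suc k) - lam ^ (2 * k)\<close> is at least
  \<open>k\<close>, so the exponential eventually beats the fixed factor
  \<open>lam powr p\<close>.\<close>

lemma summable_powr_exp_power:
  fixes lam :: real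
  assumes lam: "lam > 2" and c: "c > 0"
  shows "summable (\<lambda>k. lam powr (p * real k) * exp (- c * lam ^ (2 * k)))"
proof -
  obtain N :: nat where N: "real N \<ge> 2 * lam powr p / c"
    using real_arch_simple by blast
  show ?thesis
  proof (rule summable_ratio_test[of "1/2" N])
    fix k assume k: "k \<ge> N"
    have "lam ^ k \<ge> 2 ^ k" using lam by (intro power_mono) auto
    moreover have "real k < 2 ^ k" by (rule of_nat_less_two_power)
    ultimately have "lam ^ k \<ge> real k" by linarith
    moreover have "lam ^ k \<ge> 1" using lam by simp
    ultimately have "lam ^ k * lam ^ k \<ge> real k * 1" using lam by (intro mult_mono) auto
    moreover have "lam * lam \<ge> 2 * 2" using lam by (intro mult_mono) auto
    then have "(lam ^ k * lam ^ k) * (lam * lam) \<ge> (lam ^ k * lam ^ k) * 4" by (intro mult_left_mono) auto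
    moreover have "lam ^ (2 * Suc k) = (lam ^ k * lam ^ k) * (lam * lam)" "lam ^ (2 * k) = lam ^ k * lam ^ k"
      unfolding power_even_eq power2_eq_square power_Suc by (simp_all only: mult_ac)
    ultimately have "lam ^ (2 * Suc k) - lam ^ (2 * k) \<ge> real k" by linarith
    then have "c * (lam ^ (2 * Suc k) - lam ^ (2 * k)) \<ge> c * real N"
      using k c by (intro mult_left_mono) auto
    moreover have "c * real N \<ge> 2 * lam powr p" using N c by (simp add: field_simps)
    ultimately have "exp (c * (lam ^ (2 * Suc k) - lam ^ (2 * k))) \<ge> 2 * lam powr p"
      using exp_ge_add_one_self[of "c * (lam ^ (2 * Suc k) - lam ^ (2 * k))"] by linarith
    then have "lam powr p * exp (- (c * (lam ^ (2 * Suc k) - lam ^ (2 * k)))) \<le> 1 / 2"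
      unfolding exp_minus by (simp add: field_simps)
    then have "(lam powr p * exp (- (c * (lam ^ (2 * Suc k) - lam ^ (2 * k))))) * (lam powr (p * real k) * exp (- c * lam ^ (2 * k)))
        \<le> 1 / 2 * (lam powr (p * real k) * exp (- c * lam ^ (2 * k)))"
      by (rule mult_right_mono) simp
    moreover have "(lam powr p * exp (- (c * (lam ^ (2 * Suc k) - lam ^ (2 * k))))) * (lam powr (p * real k) * exp (- c * lam ^ (2 * k)))
        = (lam powr p * lam powr (p * real k)) * (exp (- (c * (lam ^ (2 * Suc k) - lam ^ (2 * k)))) * exp (- c * lam ^ (2 * k)))"
      by (simp only: mult_ac)
    moreover have "\<dots> = lam powr (p * real (Suc k)) * exp (- c * lam ^ (2 * Suc k))"
      by (simp only: powr_add[symmetric] exp_add[symmetric]) (simp add: algebra_simps)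
    ultimately have "lam powr (p * real (Suc k)) * exp (- c * lam ^ (2 * Suc k))
        \<le> 1 / 2 * (lam powr (p * real k) * exp (- c * lam ^ (2 * k)))"
      by (simp only:)
    moreover have "norm (lam powr x * exp y) = lam powr x * exp y" for x y by simp
    ultimately show "norm (lam powr (p * real (Suc k)) * exp (- c * lam ^ (2 * Suc k)))
        \<le> 1 / 2 * norm (lam powr (p * real k) * exp (- c * lam ^ (2 * k)))"
      by (simp only:)
  qed simp
qed

lemma summable_powr_neg:
  fixes lam :: real
  assumes lam: "lam > 1" and p: "p < 0"
  shows "summable (\<lambda>k. lam powr (p * real k))"
proof -
  have "lam powr p < lam powr 0" using assms by (intro powr_less_mono) auto
  then have "summable (\<lambda>k. (lam powr p) ^ k)" using lam by (intro summable_geometric) auto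
  then show ?thesis using lam by (simp add: powr_power mult.commute)
qed

section \<open>The solution in the original variables\<close>

theorem theorem1p1:
  fixes \<nu> \<alpha> lam :: real
  assumes "\<nu> > 0"
    and "1 \<le> \<alpha>" and "\<alpha> < 2"
    and "lam > 2 powr (1 / (2 - \<alpha>))"
  shows "\<exists>X :: real \<Rightarrow> nat \<Rightarrow> real.
      (\<forall>s < \<alpha> - 2. continuous_in_H lam s {0..} X) \<and>
      dyadic_solution \<nu> \<alpha> lam X \<and>
      (\<forall>k\<ge>1. ((\<lambda>t. X t k) \<longlongrightarrow> 0) (at_right 0)) \<and>
      (\<forall>s. continuous_in_H lam s {0<..} X) \<and>
      (\<forall>r > \<alpha> - 2.
         Limsup (at_right 0) (\<lambda>t. ereal (t powr ((r - \<alpha> + 2) / 2) * H_norm lam r (X t))) > 0) \<and>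
      (\<exists>t\<ge>0. \<exists>k\<ge>1. X t k \<noteq> 0) \<and>
      (\<forall>Y \<in> {X, \<lambda>t k. 0}.
         dyadic_solution \<nu> \<alpha> lam Y \<and>
         (\<forall>k\<ge>1. Y 0 k = 0) \<and>
         (\<forall>s < \<alpha> - 2. continuous_in_H lam s {0..} Y) \<and>
         bounded_in_B lam (\<alpha> - 2) Y)"
proof -
  have "2 powr 1 \<le> (2::real) powr (1 / (2 - \<alpha>))" using assms by (intro powr_mono) auto
  then have lam: "lam > 2" using assms by simp
  then have lam0: "lam > 0" by simp
  define \<mu> where "\<mu> = (lam powr (2 - \<alpha>))\<^sup>2"
  have "(2 powr (1 / (2 - \<alpha>))) powr (2 - \<alpha>) < lam powr (2 - \<alpha>)"
    using assms by (intro powr_less_mono2) auto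
  then have "2 < lam powr (2 - \<alpha>)" using assms by (simp add: powr_powr)
  then have mu: "\<mu> > 4" unfolding \<mu>_def using power_strict_mono[of 2 "lam powr (2 - \<alpha>)" 2] by simp
  interpret scaled_dyadic \<nu> lam \<mu> using assms lam mu by unfold_locales
  from scaled_solution_exists obtain b K c C where c: "c > 0" "C > 0"
    and b00: "\<forall>t\<ge>0. b t 0 = 0" and b0: "\<forall>k. b 0 k = 0"
    and b_bounds: "\<forall>t\<ge>0. \<forall>k. 0 \<le> b t k \<and> b t k \<le> K * exp (- \<nu> * w k * t)"
    and b': "\<forall>k\<ge>1. \<forall>t\<ge>0. ((\<lambda>t. b t k) has_real_derivative rhs (b t) k) (at t within {0..})"
    and b_window: "\<forall>k\<ge>1. \<exists>t. c / w k \<le> t \<and> t \<le> C / w k \<and> b t k \<ge> threshold"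
    by (elim exE conjE)
  have b_nn: "0 \<le> b t k" and b_decay: "b t k \<le> K * exp (- \<nu> * w k * t)" if "t \<ge> 0" for t k
    using b_bounds that by simp_all
  \<comment> \<open>\<open>q k\<close> is \<open>N_k^(2 - \<alpha>)\<close>, which undoes the
    rescaling.\<close>
  define q where "q k = lam powr ((2 - \<alpha>) * real k)" for k
  have q_pos: "q k > 0" for k using lam0 by (simp add: q_def)
  have q_Suc: "q (Suc k) = lam powr (2 - \<alpha>) * q k" for k
    by (simp add: q_def algebra_simps flip: powr_add)
  have w_q: "w k = freq lam k powr \<alpha> * q k" for k
  proof -
    have "freq lam k powr \<alpha> * q k = lam powr (2 * real k)"
      by (simp add: freq_powr[OF lam0] q_def algebra_simps flip: powr_add)
    also have "\<dots> = w k" using powr_realpow[OF lam0, of "2 * k"] by (simp add: w_def)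
    finally show ?thesis ..
  qed
  have w_freq: "w k = (freq lam k)\<^sup>2" for k by (simp add: w_def freq_def mult.commute flip: power_mult)
  have freq_q: "lam powr ((2 * s + 2 * (2 - \<alpha>)) * real k) = freq lam k powr (2 * s) * (q k)\<^sup>2" for s k
  proof -
    have "(q k)\<^sup>2 = lam powr (2 * (2 - \<alpha>) * real k)"
      by (simp add: q_def power2_eq_square algebra_simps flip: powr_add)
    then show ?thesis by (simp add: freq_powr[OF lam0] distrib_right powr_add)
  qed
  define X where "X t k = q k * b t k" for t k
  have X_bound: "\<bar>X t k\<bar> \<le> q k * (K * exp (- \<nu> * w k * t))" if "t \<ge> 0" for t k
    using b_nn[OF that] b_decay[OF that] q_pos[of k] by (simp add: X_def abs_mult)
  have K0: "K \<ge> 0" using b_nn[of 0 0] b_decay[of 0 0] by simp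
  have b_le: "b t k \<le> K" if "t \<ge> 0" for t k
  proof -
    have "K * exp (- \<nu> * w k * t) \<le> K * 1"
      using K0 that assms w_pos[of k] by (intro mult_left_mono) auto
    then show ?thesis using b_decay[OF that, of k] by linarith
  qed
  have X': "((\<lambda>u. X u k) has_real_derivative
        (- \<nu> * (freq lam k)\<^sup>2 * X t k + freq lam k powr \<alpha> * (X t (k + 1))\<^sup>2
         - freq lam (k - 1) powr \<alpha> * X t (k - 1) * X t k)) (at t within {0..})" if k: "k \<ge> 1" and t: "t \<ge> 0" for k t
  proof -
    obtain j where j: "k = Suc j" using k by (cases k) auto
    have "q k * rhs (b t) k = - \<nu> * w k * (q k * b t k)
        + (w k * q k) * (\<mu> * (b t (k + 1))\<^sup>2) - (w (Suc j) / lam\<^sup>2) * b t j * (q k * b t k)"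
      by (simp add: rhs_def j algebra_simps)
    also have "w (Suc j) / lam\<^sup>2 = w j" using lam by (simp add: w_Suc)
    also have "(w k * q k) * (\<mu> * (b t (k + 1))\<^sup>2) = freq lam k powr \<alpha> * (X t (k + 1))\<^sup>2"
      by (simp add: X_def q_Suc w_q \<mu>_def power_mult_distrib power2_eq_square)
    also have "w j * b t j * (q k * b t k) = freq lam (k - 1) powr \<alpha> * X t (k - 1) * X t k"
      by (simp add: X_def w_q j)
    finally have "q k * rhs (b t) k = - \<nu> * (freq lam k)\<^sup>2 * X t k + freq lam k powr \<alpha> * (X t (k + 1))\<^sup>2
         - freq lam (k - 1) powr \<alpha> * X t (k - 1) * X t k" by (simp add: X_def w_freq)
    moreover have "((\<lambda>u. X u k) has_real_derivative q k * rhs (b t) k) (at t within {0..})"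
      unfolding X_def by (rule DERIV_cmult[OF b'[rule_format, OF k t]])
    ultimately show ?thesis by (simp only:)
  qed
  have X_cont: "continuous_on {0..} (\<lambda>t. X t k)" if "k \<ge> 1" for k
    by (rule DERIV_continuous_on[OF X'[OF that]]) simp
  have X0: "X 0 k = 0" for k by (simp add: X_def b0)
  have sol: "dyadic_solution \<nu> \<alpha> lam X"
    unfolding dyadic_solution_def using X' X_cont b00 by (simp add: X_def)
  have H_low: "continuous_in_H lam s {0..} X" if s: "s < \<alpha> - 2" for s
  proof (rule continuous_in_H_dominated)
    show "continuous_on {0..} (\<lambda>t. X t (Suc k))" for k by (rule X_cont) simp
    fix t\<^sub>0 :: real assume "t\<^sub>0 \<in> {0..}"
    \<comment> \<open>Without the exponential factor the bound \<open>q k * K\<close> holds up to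
      \<open>t = 0\<close>, and its norm is a geometric series whose exponent is negative for
      \<open>s < \<alpha> - 2\<close>.\<close>
    have "summable (\<lambda>k. K\<^sup>2 * lam powr ((2 * s + 2 * (2 - \<alpha>)) * real (Suc k)))"
      using summable_powr_neg[of lam "2 * s + 2 * (2 - \<alpha>)"] lam s
      by (intro summable_mult summable_Suc_iff[THEN iffD2]) auto
    also have "(\<lambda>k. K\<^sup>2 * lam powr ((2 * s + 2 * (2 - \<alpha>)) * real (Suc k)))
        = (\<lambda>k. freq lam (Suc k) powr (2 * s) * (q (Suc k) * K)\<^sup>2)"
      unfolding freq_q power_mult_distrib by (simp only: mult_ac)
    finally have "summable \<dots>" .
    moreover have "\<bar>X t (Suc k)\<bar> \<le> q (Suc k) * K" if "t \<ge> 0" for t k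
      using b_le[OF that] b_nn[OF that] q_pos[of "Suc k"] by (simp add: X_def abs_mult)
    ultimately show "\<exists>e>0. \<exists>M. summable (\<lambda>k. freq lam (Suc k) powr (2 * s) * (M k)\<^sup>2) \<and>
        (\<forall>t\<in>{0..}. \<bar>t - t\<^sub>0\<bar> < e \<longrightarrow> (\<forall>k. \<bar>X t (Suc k)\<bar> \<le> M k))"
      by (intro exI[of _ 1] exI[of _ "\<lambda>k. q (Suc k) * K"]) auto
  qed
  have H_pos: "continuous_in_H lam s {0<..} X" for s
  proof (rule continuous_in_H_dominated)
    show "continuous_on {0<..} (\<lambda>t. X t (Suc k))" for k
      by (rule continuous_on_subset[OF X_cont]) auto
    fix t\<^sub>0 :: real assume t0: "t\<^sub>0 \<in> {0<..}"
    \<comment> \<open>Times within \<open>t\<^sub>0 / 2\<close> of \<open>t\<^sub>0\<close> are at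
      least \<open>t\<^sub>0 / 2\<close>, so the decay bound at that time majorizes them
      all.\<close>
    define M where "M k = q (Suc k) * (K * exp (- \<nu> * w (Suc k) * (t\<^sub>0 / 2)))" for k
    have "summable (\<lambda>k. K\<^sup>2 * (lam powr ((2 * s + 2 * (2 - \<alpha>)) * real (Suc k)) * exp (- (\<nu> * t\<^sub>0) * lam ^ (2 * Suc k))))"
      using summable_powr_exp_power[of lam "\<nu> * t\<^sub>0" "2 * s + 2 * (2 - \<alpha>)"] lam t0 assms
      by (intro summable_mult summable_Suc_iff[THEN iffD2]) auto
    also have "(\<lambda>k. K\<^sup>2 * (lam powr ((2 * s + 2 * (2 - \<alpha>)) * real (Suc k)) * exp (- (\<nu> * t\<^sub>0) * lam ^ (2 * Suc k))))
        = (\<lambda>k. freq lam (Suc k) powr (2 * s) * (M k)\<^sup>2)"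
    proof
      fix k
      have "exp (- (\<nu> * t\<^sub>0) * lam ^ (2 * Suc k)) = (exp (- \<nu> * w (Suc k) * (t\<^sub>0 / 2)))\<^sup>2"
        by (simp add: w_def flip: exp_double)
      moreover have "lam powr ((2 * s + 2 * (2 - \<alpha>)) * real (Suc k)) = freq lam (Suc k) powr (2 * s) * (q (Suc k))\<^sup>2"
        by (rule freq_q)
      ultimately show "K\<^sup>2 * (lam powr ((2 * s + 2 * (2 - \<alpha>)) * real (Suc k)) * exp (- (\<nu> * t\<^sub>0) * lam ^ (2 * Suc k)))
        = freq lam (Suc k) powr (2 * s) * (M k)\<^sup>2"
        by (simp only: M_def power_mult_distrib mult_ac)
    qed
    finally have "summable \<dots>" .
    moreover have "\<bar>X t (Suc k)\<bar> \<le> M k" if "t \<in> {0<..}" "\<bar>t - t\<^sub>0\<bar> < t\<^sub>0 / 2" for t k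
    proof -
      have "t\<^sub>0 / 2 \<le> t" using that(2) by arith
      then have "\<nu> * w (Suc k) * (t\<^sub>0 / 2) \<le> \<nu> * w (Suc k) * t"
        using nu_pos w_pos[of "Suc k"] by (intro mult_left_mono) auto
      then have "q (Suc k) * (K * exp (- \<nu> * w (Suc k) * t)) \<le> M k"
        unfolding M_def using K0 q_pos[of "Suc k"] by (intro mult_left_mono) auto
      then show ?thesis using X_bound[of t "Suc k"] that by simp
    qed
    ultimately show "\<exists>e>0. \<exists>M. summable (\<lambda>k. freq lam (Suc k) powr (2 * s) * (M k)\<^sup>2) \<and>
        (\<forall>t\<in>{0<..}. \<bar>t - t\<^sub>0\<bar> < e \<longrightarrow> (\<forall>k. \<bar>X t (Suc k)\<bar> \<le> M k))"
      using t0 by (intro exI[of _ "t\<^sub>0 / 2"] exI[of _ M]) auto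
  qed
  have X_lim: "((\<lambda>t. X t k) \<longlongrightarrow> 0) (at_right 0)" if "k \<ge> 1" for k
  proof -
    have "((\<lambda>t. X t k) \<longlongrightarrow> X 0 k) (at 0 within {0..})"
      using X_cont[OF that] by (simp add: continuous_on_def)
    then show ?thesis unfolding X0 by (rule tendsto_within_subset) auto
  qed
  have X_Limsup: "Limsup (at_right 0) (\<lambda>t. ereal (t powr ((r - \<alpha> + 2) / 2) * H_norm lam r (X t))) > 0"
    if r: "r > \<alpha> - 2" for r
  proof -
    define \<beta> where "\<beta> = (r - \<alpha> + 2) / 2"
    have \<beta>: "\<beta> > 0" using r by (simp add: \<beta>_def)
    \<comment> \<open>The \<open>k\<close>-th term alone contributes
      \<open>N_k^r * q k * threshold = (w k) powr \<beta> * threshold\<close>, and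
      \<open>t \<ge> c / w k\<close> makes the product with \<open>t powr \<beta>\<close> at least
      \<open>\<epsilon>\<close> for every \<open>k\<close>.\<close>
    define \<epsilon> where "\<epsilon> = c powr \<beta> * threshold"
    have eps: "\<epsilon> > 0" using c threshold_pos by (simp add: \<epsilon>_def)
    have big: "\<epsilon> \<le> t powr \<beta> * H_norm lam r (X t)" if k: "k \<ge> 1" and t: "c / w k \<le> t" "b t k \<ge> threshold" for t k
    proof -
      have cw: "c / w k > 0" using c w_pos by simp
      then have t0: "t > 0" using t by linarith
      then have "X t \<in> H_space lam r" using H_pos[of r] by (simp add: continuous_in_H_def)
      then have "freq lam k powr r * \<bar>X t k\<bar> \<le> H_norm lam r (X t)"
        using H_norm_ge_term[of "X t" lam r "k - 1"] k by simp
      moreover have "freq lam k powr r * (q k * threshold) \<le> freq lam k powr r * \<bar>X t k\<bar>"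
        using t b_nn[of t k] t0 q_pos[of k] by (intro mult_left_mono) (auto simp: X_def abs_mult)
      ultimately have H: "freq lam k powr r * (q k * threshold) \<le> H_norm lam r (X t)" by linarith
      have "(w k) powr \<beta> = freq lam k powr r * q k"
      proof -
        have "w k = lam powr (2 * real k)" using powr_realpow[OF lam0, of "2 * k"] by (simp add: w_def)
        then have "(w k) powr \<beta> = lam powr (2 * real k * \<beta>)" by (simp add: powr_powr)
        also have "2 * real k * \<beta> = r * real k + (2 - \<alpha>) * real k" by (simp add: \<beta>_def field_simps)
        finally show ?thesis by (simp add: freq_powr[OF lam0] q_def powr_add)
      qed
      then have "\<epsilon> = (c / w k) powr \<beta> * (freq lam k powr r * (q k * threshold))"
      proof -
        have "(c / w k) powr \<beta> * (w k) powr \<beta> = c powr \<beta>"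
          using c w_pos[of k] by (simp add: powr_divide)
        then show ?thesis using \<open>(w k) powr \<beta> = _\<close> by (simp add: \<epsilon>_def flip: mult.assoc)
      qed
      also have "\<dots> \<le> t powr \<beta> * H_norm lam r (X t)"
        using cw t H \<beta> threshold_pos q_pos[of k] by (intro mult_mono powr_mono2) auto
      finally show ?thesis .
    qed
    have "\<exists>\<^sub>F t in at_right 0. ereal \<epsilon> \<le> ereal (t powr \<beta> * H_norm lam r (X t))"
      unfolding frequently_def eventually_at_right_field
    proof
      assume "\<exists>d>0. \<forall>y>0. y < d \<longrightarrow> \<not> ereal \<epsilon> \<le> ereal (y powr \<beta> * H_norm lam r (X y))"
      then obtain d where d: "d > 0" "\<And>y. y > 0 \<Longrightarrow> y < d \<Longrightarrow> \<not> \<epsilon> \<le> y powr \<beta> * H_norm lam r (X y)"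
        by auto
      \<comment> \<open>The windows shrink to \<open>0\<close>, so every right neighbourhood of
        \<open>0\<close> contains one of them.\<close>
      obtain k where k: "C / d < lam ^ k" using real_arch_pow[of lam "C / d"] lam by auto
      have "lam ^ k \<le> lam ^ (2 * Suc k)" using lam by (intro power_increasing) auto
      then have "C / d < w (Suc k)" using k by (simp only: w_def)
      then have "C / w (Suc k) < d" using d w_pos[of "Suc k"] by (simp add: field_simps)
      moreover obtain t where t: "c / w (Suc k) \<le> t" "t \<le> C / w (Suc k)" "b t (Suc k) \<ge> threshold"
        using b_window[rule_format, of "Suc k"] by auto
      moreover have "c / w (Suc k) > 0" using c w_pos by simp
      ultimately show False using d(2)[of t] big[of "Suc k" t] by simp
    qed
    then have "ereal \<epsilon> \<le> Limsup (at_right 0) (\<lambda>t. ereal (t powr \<beta> * H_norm lam r (X t)))"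
      by (rule Limsup_ge_frequently)
    then show ?thesis using eps unfolding \<beta>_def by (meson ereal_less(2) less_le_trans)
  qed
  have nontrivial: "\<exists>t\<ge>0. \<exists>k\<ge>1. X t k \<noteq> 0"
  proof -
    obtain t where t: "c / w 1 \<le> t" "b t 1 \<ge> threshold" using b_window[rule_format, of 1] by auto
    have "c / w 1 > 0" using c w_pos by simp
    then have "t \<ge> 0" using t by linarith
    moreover have "X t 1 \<noteq> 0" using t threshold_pos q_pos[of 1] by (simp add: X_def)
    ultimately show ?thesis by (intro exI[of _ t] exI[of _ 1] conjI) auto
  qed
  have X_B: "bounded_in_B lam (\<alpha> - 2) X"
    unfolding bounded_in_B_def B_norm_def
  proof (intro exI[of _ K] allI impI SUP_least)
    fix t :: real and k :: nat assume t: "t \<ge> 0"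
    have "freq lam k powr (\<alpha> - 2) * q k = 1"
      using lam0 by (simp add: freq_powr[OF lam0] q_def left_diff_distrib flip: powr_add)
    then have "freq lam k powr (\<alpha> - 2) * \<bar>X t k\<bar> = b t k"
      using b_nn[OF t, of k] q_pos[of k] by (simp add: X_def abs_mult flip: mult.assoc)
    then show "ereal (freq lam k powr (\<alpha> - 2) * \<bar>X t k\<bar>) \<le> ereal K" using b_le[OF t] by simp
  qed
  have zero: "dyadic_solution \<nu> \<alpha> lam (\<lambda>t k. 0)" "continuous_in_H lam s {0..} (\<lambda>t k. 0)"
    "bounded_in_B lam (\<alpha> - 2) (\<lambda>t k. 0)" for s
    by (auto simp: dyadic_solution_def continuous_in_H_def H_space_def H_norm_def bounded_in_B_def B_norm_def
        intro!: exI[of _ 0] SUP_least)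
  show ?thesis
    using H_low sol X_lim H_pos X_Limsup nontrivial X0 X_B zero
    by (intro exI[of _ X] conjI ballI allI impI) auto
qed

end
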